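(* $$\int_{0}^{1}\frac{\mathbf K\big(2\sqrt{x(1-x)}\big)}{\sqrt{\frac{9}{8}+\frac{1-2x}{\sqrt{2}}}}\,dx=\frac{\big[\Gamma\big(\frac{1}{4}\big)\big]^4}{16\sqrt{2}\,\pi}.$$
   Context: $\mathbf K(k)=\int_0^{\pi/2}\frac{d\theta}{\sqrt{1-k^2\sin^2\theta}}$ denotes the complete elliptic integral of the first kind with modulus $k$, and $\Gamma(s)=\int_0^\infty t^{s-1}e^{-t}\,dt$ (for $\operatorname{Re}s>0$) is Euler's gamma function. *)

theory Defs
  imports "HOL-Analysis.Analysis"
begin

text \<open>
  The argument is the modulus k, not the parameter m = k^2. The definition is meaningful for
  \<^term>\<open>\<bar>k\<bar> < (1::real)\<close>. At modulus 1 the integral diverges, and the Isabelle value there is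
  the library's default 0 for non-integrable functions.
\<close>

definition ellipticK :: "real \<Rightarrow> real" where
  "ellipticK k = integral {0..pi/2} (\<lambda>\<theta>. 1 / sqrt (1 - k\<^sup>2 * (sin \<theta>)\<^sup>2))"

end

theory Submission
  imports Defs
begin

text \<open>
  Put \<open>h = 1 / (2 sqrt 2)\<close> and \<open>c = sqrt (1 + h\<^sup>2) = 3 / (2 sqrt 2)\<close>. With \<open>z = 1 - 2 x\<close> the modulus
  becomes \<open>sqrt (1 - z\<^sup>2)\<close> and the other factor becomes \<open>1 / sqrt (1 + h\<^sup>2 + 2 h z)\<close>, the reciprocal
  distance that generates the Legendre polynomials. The proof turns the integral into the square
  of one complete elliptic integral, which happens to be lemniscatic.

  (1) The function \<open>z \<mapsto> K (sqrt (1 - z\<^sup>2))\<close> is, up to a factor, the density of the product of two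
  independent arcsine-distributed variables \<open>cos \<theta>\<close> and \<open>cos \<psi>\<close>: on the unit sphere this says that
  polar coordinates may be taken around an equatorial axis instead of the z-axis. Hence
  (\<open>ellipticK_has_integral\<close>) the integral is half of the double integral of
  \<open>1 / sqrt (1 + h\<^sup>2 - 2 h cos \<theta> cos \<psi>)\<close> over \<open>[0, \<pi>/2] \<times> [0, \<pi>]\<close>.

  (2) Expanding in powers of \<open>cos \<theta> cos \<psi>\<close> and integrating gives a hypergeometric series in
  \<open>h\<^sup>2 / (1 + h\<^sup>2)\<^sup>2\<close>. Rearranging it in powers of \<open>h\<^sup>2\<close> produces inner sums that are balanced
  terminating 3F2 series at 1, summable in closed form (\<open>saalschuetz_sum\<close>). The result
  (\<open>integral_distance_series\<close>) is \<open>\<pi>\<^sup>2 / 2\<close> times \<open>\<Sum> a(n)^3 (- h\<^sup>2)^n\<close>, where \<open>a(n)\<close> are the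
  coefficients of \<open>1 / sqrt (1 - t)\<close>.

  (3) The same series is, up to the factor \<open>4 \<pi>\<^sup>2\<close>, the integral of
  \<open>1 / sqrt (1 + h\<^sup>2 cos\<^sup>2 (\<phi>/2) cos\<^sup>2 \<psi>)\<close> over the torus (\<open>integral_torus_series\<close>).

  (4) This torus integral is the square of the integral of \<open>1 / sqrt (c + h cos \<psi>)\<close> over a period
  (\<open>legendre_product_formula\<close>). It is the case of Clausen's identity that is needed here, and is
  obtained from Landen's transformation together with the product formula of the spherical
  function of degree -1/2 on the hyperbolic plane.

  (5) For this particular \<open>h\<close> the factor is \<open>1 / sqrt (1 + cos\<^sup>2)\<close> up to scaling, a Beta integral
  (\<open>integral_lemniscatic\<close>), and the reflection formula turns its square into \<open>\<Gamma>(1/4)^4\<close>.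
\<close>

section \<open>The coefficients of the inverse square root\<close>

definition inv_sqrt_coeff :: "nat \<Rightarrow> real" where
  "inv_sqrt_coeff n = pochhammer (1/2) n / fact n"

lemma inv_sqrt_coeff_0 [simp]: "inv_sqrt_coeff 0 = 1"
  by (simp add: inv_sqrt_coeff_def)

lemma inv_sqrt_coeff_Suc: "inv_sqrt_coeff (Suc n) = (real n + 1/2) / (real n + 1) * inv_sqrt_coeff n"
  by (simp add: inv_sqrt_coeff_def pochhammer_Suc field_simps)

lemma inv_sqrt_coeff_nonneg: "0 \<le> inv_sqrt_coeff n"
  by (simp add: inv_sqrt_coeff_def pochhammer_nonneg)

lemma inv_sqrt_coeff_le_1: "inv_sqrt_coeff n \<le> 1"
proof (induction n)
  case (Suc n)
  have "(real n + 1/2) / (real n + 1) * inv_sqrt_coeff n \<le> 1 * 1"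
    by (intro mult_mono Suc inv_sqrt_coeff_nonneg) (auto simp: field_simps)
  then show ?case by (simp add: inv_sqrt_coeff_Suc)
qed simp

lemma pochhammer_half_double:
  "pochhammer (1/2::real) m = fact (2 * m) / (4 ^ m * fact m)"
proof (induction m)
  case (Suc m)
  have f: "fact (2 * Suc m) = (2 * real m + 2) * (2 * real m + 1) * (fact (2 * m) :: real)"
    by (simp add: algebra_simps)
  show ?case
    unfolding f pochhammer_Suc Suc.IH fact_Suc power_Suc
    by (simp add: divide_simps) (simp add: algebra_simps)
qed simp

lemma binomial_minus_real:
  fixes x a :: real
  assumes "\<bar>x\<bar> < 1"
  shows "(\<lambda>k. pochhammer a k / fact k * x ^ k) sums ((1 - x) powr (- a))"
proof -
  have "((- a) gchoose k) * (- x) ^ k = pochhammer a k / fact k * x ^ k" for k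
    unfolding gbinomial_pochhammer power_minus[of x] by simp
  then show ?thesis
    using gen_binomial_real[of "- x" "- a"] assms by simp
qed

lemma inverse_sqrt_sums:
  fixes t :: real
  assumes "\<bar>t\<bar> < 1"
  shows "(\<lambda>n. inv_sqrt_coeff n * t ^ n) sums (1 / sqrt (1 - t))"
  using binomial_minus_real[OF assms, of "1/2"] assms powr_minus_divide[of "1 - t" "1/2"]
    powr_half_sqrt[of "1 - t"]
  by (simp add: inv_sqrt_coeff_def)

lemma summable_inv_sqrt_coeff_power:
  assumes "\<bar>r\<bar> < 1"
  shows "summable (\<lambda>n. \<bar>inv_sqrt_coeff n * r ^ n\<bar>)"
proof (rule summable_comparison_test'[where N = 0])
  show "summable (\<lambda>n. \<bar>r\<bar> ^ n)" using assms by (intro summable_geometric) simp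
  show "norm \<bar>inv_sqrt_coeff n * r ^ n\<bar> \<le> \<bar>r\<bar> ^ n" for n
    using inv_sqrt_coeff_le_1[of n] inv_sqrt_coeff_nonneg[of n] by (simp add: abs_mult power_abs mult_left_le_one_le)
qed

section \<open>A balanced terminating hypergeometric sum\<close>

text \<open>
  Up to the factor \<open>pochhammer (1/2) n / fact n\<close> these are the terms of the 3F2 series with numerator
  parameters \<open>-n, n + 1/2, 1/2\<close> and denominator parameters \<open>1, 1\<close> at argument 1, which is balanced,
  so that Saalschuetz's theorem applies. The factor \<open>fact (n - m)\<close> in the denominator is only
  meaningful for \<open>m \<le> n\<close>.
\<close>

definition saalschuetz_term :: "nat \<Rightarrow> nat \<Rightarrow> real" where
  "saalschuetz_term n m = (-1) ^ m * pochhammer (1/2) (n + m) * inv_sqrt_coeff m / (fact m ^ 2 * fact (n - m))"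

text \<open>
  The Wilf-Zeilberger partner of the summand: the term \<open>saalschuetz_term n m\<close> times
  \<open>- 2 (n + 3/4) m^3 / (n + 1 - m)\<close>. Absorbing the denominator into the factorial keeps the
  expression meaningful at \<open>m = n + 1\<close>, where it supplies the last term of the next row.
\<close>

definition saalschuetz_certificate :: "nat \<Rightarrow> nat \<Rightarrow> real" where
  "saalschuetz_certificate n m = - 2 * (real n + 3/4) * real m ^ 3 *
     ((-1) ^ m * pochhammer (1/2) (n + m) * inv_sqrt_coeff m / (fact m ^ 2 * fact (Suc n - m)))"

lemma saalschuetz_step:
  assumes "m \<le> n"
  shows "(real n + 1) ^ 3 * saalschuetz_term (Suc n) m - (real n + 1/2) ^ 3 * saalschuetz_term n m
           = saalschuetz_certificate n (Suc m) - saalschuetz_certificate n m"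
proof -
  obtain d where n: "n = m + d" using assms le_Suc_ex by blast
  define P where "P = (-1) ^ m * pochhammer (1/2) (n + m) * inv_sqrt_coeff m / (fact m ^ 2 * fact d)"
  have s: "saalschuetz_term n m = P" by (simp add: saalschuetz_term_def P_def n)
  have s1: "saalschuetz_term (Suc n) m = P * (real n + real m + 1/2) / (real d + 1)"
    by (simp add: saalschuetz_term_def P_def n pochhammer_Suc Suc_diff_le divide_simps) (simp add: algebra_simps)
  have c: "saalschuetz_certificate n m = - 2 * (real n + 3/4) * real m ^ 3 * P / (real d + 1)"
    by (simp add: saalschuetz_certificate_def P_def n Suc_diff_le divide_simps)
  have c1: "saalschuetz_certificate n (Suc m)
      = 2 * (real n + 3/4) * P * (real n + real m + 1/2) * (real m + 1/2)"
  proof -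
    have "saalschuetz_certificate n (Suc m) = - 2 * (real n + 3/4) * (real m + 1) ^ 3 *
       (- ((-1) ^ m) * (pochhammer (1/2) (n + m) * (1/2 + real (n+m))) *
        ((real m + 1/2) / (real m + 1) * inv_sqrt_coeff m) / (((real m + 1) * fact m) ^ 2 * fact d))"
      by (simp add: saalschuetz_certificate_def n pochhammer_Suc inv_sqrt_coeff_Suc add.commute)
    also have "\<dots> = 2 * (real n + 3/4) * P * (real n + real m + 1/2) * (real m + 1/2)"
      by (simp add: P_def divide_simps) (simp add: algebra_simps power2_eq_square power3_eq_cube)
    finally show ?thesis .
  qed
  have key: "(real n + 1) ^ 3 * (real n + real m + 1/2) - (real n + 1/2) ^ 3 * (real d + 1)
     = 2 * (real n + 3/4) * ((real n + real m + 1/2) * (real m + 1/2) * (real d + 1) + real m ^ 3)"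
    unfolding n by (simp add: field_simps power3_eq_cube)
  have rearrange: "p * (2 * k * (u * v * e + w)) / e = 2 * k * p * u * v - - 2 * k * w * p / e"
    if "e \<noteq> 0" for p k u v w e :: real
    using that by (simp add: field_simps)
  have "(real n + 1) ^ 3 * (P * (real n + real m + 1/2) / (real d + 1)) - (real n + 1/2) ^ 3 * P
      = P * (2 * (real n + 3/4) * ((real n + real m + 1/2) * (real m + 1/2) * (real d + 1) + real m ^ 3)) / (real d + 1)"
    unfolding key[symmetric] by (simp add: diff_divide_distrib right_diff_distrib mult.left_commute)
  also have "\<dots> = 2 * (real n + 3/4) * P * (real n + real m + 1/2) * (real m + 1/2)
      - - 2 * (real n + 3/4) * real m ^ 3 * P / (real d + 1)"
    by (rule rearrange) simp
  finally show ?thesis unfolding s s1 c c1 by (simp add: mult_ac)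
qed

text \<open>
  The certificate telescopes over a row, so the row sums obey the first-order recurrence that the
  cubes of the coefficients obey.
\<close>

lemma saalschuetz_sum: "(\<Sum>m\<le>n. saalschuetz_term n m) = inv_sqrt_coeff n ^ 3"
proof (induction n)
  case 0
  show ?case by (simp add: saalschuetz_term_def)
next
  case (Suc n)
  have "(\<Sum>m\<le>n. (real n + 1) ^ 3 * saalschuetz_term (Suc n) m - (real n + 1/2) ^ 3 * saalschuetz_term n m)
      = (\<Sum>m\<le>n. saalschuetz_certificate n (Suc m) - saalschuetz_certificate n m)"
    by (intro sum.cong saalschuetz_step) auto
  also have "\<dots> = saalschuetz_certificate n (Suc n) - saalschuetz_certificate n 0"
    using sum_lessThan_telescope[of "saalschuetz_certificate n" "Suc n"] by (simp add: lessThan_Suc_atMost)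
  also have "saalschuetz_certificate n 0 = 0"
    by (simp add: saalschuetz_certificate_def)
  also have "saalschuetz_certificate n (Suc n) = - ((real n + 1) ^ 3 * saalschuetz_term (Suc n) (Suc n))"
    by (simp add: saalschuetz_certificate_def saalschuetz_term_def pochhammer_Suc divide_simps) (simp add: algebra_simps)
  finally have "(real n + 1) ^ 3 * (\<Sum>m\<le>Suc n. saalschuetz_term (Suc n) m) = (real n + 1/2) ^ 3 * inv_sqrt_coeff n ^ 3"
    by (simp add: sum_subtractf Suc.IH flip: sum_distrib_left) (simp add: algebra_simps)
  then have "(\<Sum>m\<le>Suc n. saalschuetz_term (Suc n) m) = (real n + 1/2) ^ 3 * inv_sqrt_coeff n ^ 3 / (real n + 1) ^ 3"
    by (simp add: eq_divide_eq mult.commute)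
  then show ?case
    by (simp only: inv_sqrt_coeff_Suc power_mult_distrib power_divide times_divide_eq_left)
qed

section \<open>A quadratic transformation of hypergeometric series\<close>

text \<open>
  Expanding each \<open>(1 + y) powr (-(2 m + 1/2))\<close> binomially and collecting powers of \<open>y\<close> leaves the
  balanced sums above as coefficients. The hypothesis \<open>4 y < (1 - y)\<^sup>2\<close> is what makes the double
  series converge absolutely: with all signs made positive, \<open>1 + y\<close> is replaced by \<open>1 - y\<close>, and the
  outer series is dominated by a geometric one with ratio \<open>4 y / (1 - y)\<^sup>2\<close>.
\<close>

lemma double_series_identity:
  fixes y :: real
  assumes y: "0 \<le> y" "y < 1" "4 * y < (1 - y)\<^sup>2"
  shows "(\<lambda>m. inv_sqrt_coeff (2 * m) * inv_sqrt_coeff m ^ 2 * (4 * y) ^ m * (1 + y) powr (- (2 * real m + 1/2))) sums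
           (\<Sum>n. inv_sqrt_coeff n ^ 3 * (- y) ^ n)"
proof -
  define b where "b m = inv_sqrt_coeff (2 * m) * inv_sqrt_coeff m ^ 2 * (4 * y) ^ m" for m
  define q where "q m k = pochhammer (2 * real m + 1/2) k / fact k" for m k
  define f where "f = (\<lambda>(m, k). b m * (q m k * (- y) ^ k))"
  have b0: "b m \<ge> 0" for m using y by (simp add: b_def inv_sqrt_coeff_nonneg)
  have q0: "q m k \<ge> 0" for m k by (simp add: q_def pochhammer_nonneg)
  have inner_abs: "((\<lambda>k. norm (f (m, k))) has_sum b m * (1 - y) powr (- (2 * real m + 1/2))) UNIV" for m
  proof -
    have "(\<lambda>k. q m k * y ^ k) sums ((1 - y) powr (- (2 * real m + 1/2)))"
      unfolding q_def using y by (intro binomial_minus_real) auto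
    then have "(\<lambda>k. b m * (q m k * y ^ k)) sums (b m * (1 - y) powr (- (2 * real m + 1/2)))"
      by (rule sums_mult)
    then have "((\<lambda>k. b m * (q m k * y ^ k)) has_sum (b m * (1 - y) powr (- (2 * real m + 1/2)))) UNIV"
      using y by (intro sums_nonneg_imp_has_sum mult_nonneg_nonneg b0 q0) auto
    then show ?thesis
      using y by (simp add: f_def abs_mult b0 q0 power_abs)
  qed
  have inner: "((\<lambda>k. f (m, k)) has_sum b m * (1 + y) powr (- (2 * real m + 1/2))) UNIV" for m
  proof -
    have "(\<lambda>k. q m k * (- y) ^ k) sums ((1 - (- y)) powr (- (2 * real m + 1/2)))"
      unfolding q_def using y by (intro binomial_minus_real) auto
    then have "(\<lambda>k. b m * (q m k * (- y) ^ k)) sums (b m * (1 + y) powr (- (2 * real m + 1/2)))"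
      by (intro sums_mult) simp
    moreover have "summable (\<lambda>k. norm (f (m, k)))"
      using has_sum_imp_sums[OF inner_abs[of m]] by (simp add: sums_iff)
    ultimately show ?thesis
      by (intro norm_summable_imp_has_sum) (auto simp: f_def)
  qed
  have outer_abs: "(\<lambda>m. b m * (1 - y) powr (- (2 * real m + 1/2))) summable_on UNIV"
  proof -
    define r where "r = 4 * y / (1 - y)\<^sup>2"
    have r: "0 \<le> r" "r < 1" using y by (auto simp: r_def divide_simps)
    have "b m * (1 - y) powr (- (2 * real m + 1/2)) \<le> (1 - y) powr (- (1/2)) * r ^ m" for m
    proof -
      have "(1 - y) powr (- (2 * real m + 1/2)) = (1 - y) powr (- (1/2) - real (2 * m))"
        by (rule arg_cong[where f = "\<lambda>e. (1 - y) powr e"]) simp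
      also have "\<dots> = (1 - y) powr (- (1/2)) / (1 - y) ^ (2 * m)"
        using y by (subst powr_diff, subst powr_realpow) auto
      finally have *: "(1 - y) powr (- (2 * real m + 1/2)) = (1 - y) powr (- (1/2)) / ((1 - y)\<^sup>2) ^ m"
        by (simp add: power_mult)
      have "b m \<le> 1 * 1 ^ 2 * (4 * y) ^ m"
        unfolding b_def using y by (intro mult_mono power_mono inv_sqrt_coeff_nonneg inv_sqrt_coeff_le_1 mult_nonneg_nonneg) auto
      then have "b m * (1 - y) powr (- (2 * real m + 1/2)) \<le> (4 * y) ^ m * (1 - y) powr (- (2 * real m + 1/2))"
        by (intro mult_right_mono) auto
      also have "\<dots> = (1 - y) powr (- (1/2)) * r ^ m"
        unfolding * r_def power_divide by simp
      finally show ?thesis .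
    qed
    note bound = this
    have "summable (\<lambda>m. (1 - y) powr (- (1/2)) * r ^ m)"
      using r by (intro summable_mult summable_geometric) auto
    then have "summable (\<lambda>m. b m * (1 - y) powr (- (2 * real m + 1/2)))"
      by (rule summable_comparison_test'[where N = 0]) (use bound in \<open>simp add: abs_mult b0\<close>)
    then show ?thesis
      by (intro norm_summable_imp_summable_on) (simp add: abs_mult b0)
  qed
  have "(\<lambda>m. norm (infsum (\<lambda>k. norm (f (m, k))) UNIV)) summable_on UNIV"
    unfolding infsumI[OF inner_abs] using outer_abs by (simp add: abs_mult b0)
  then have "(\<lambda>p. norm (f p)) summable_on (Sigma UNIV (\<lambda>_. UNIV))"
    using inner_abs
    by (subst Infinite_Sum.abs_summable_on_Sigma_iff) (auto intro: has_sum_imp_summable)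
  then have sum: "f summable_on (Sigma UNIV (\<lambda>_. UNIV))"
    by (rule Infinite_Sum.abs_summable_summable)
  define tot where "tot = infsum f (Sigma UNIV (\<lambda>_. UNIV))"
  have hs: "(f has_sum tot) (Sigma UNIV (\<lambda>_. UNIV))"
    using sum unfolding tot_def by simp
  have hs1: "((\<lambda>m. b m * (1 + y) powr (- (2 * real m + 1/2))) has_sum tot) UNIV"
    by (rule has_sum_SigmaD[OF hs]) (rule inner)
  \<comment> \<open>regroup the double series by the total power \<open>n = m + k\<close> of \<open>y\<close>\<close>
  have bij: "bij_betw (\<lambda>(n, m). (m, n - m)) (Sigma UNIV (\<lambda>n. {..n})) (Sigma UNIV (\<lambda>_. UNIV :: nat set))"
    by (rule bij_betwI[where g = "\<lambda>(m, k). (m + k, m)"]) auto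
  have hs2: "((\<lambda>(n, m). f (m, n - m)) has_sum tot) (Sigma UNIV (\<lambda>n. {..n}))"
    using hs has_sum_reindex_bij_betw[OF bij, of f tot] by (simp add: case_prod_unfold)
  have diag: "(\<Sum>m\<le>n. f (m, n - m)) = inv_sqrt_coeff n ^ 3 * (- y) ^ n" for n
  proof -
    have "f (m, n - m) = (- y) ^ n * saalschuetz_term n m" if "m \<le> n" for m
    proof -
      obtain k where n: "n = m + k" using \<open>m \<le> n\<close> le_Suc_ex by blast
      have p: "pochhammer (1/2) (n + m) = pochhammer (1/2::real) (2 * m) * pochhammer (2 * real m + 1/2) k"
      proof -
        have "n + m = 2 * m + k" by (simp add: n)
        then show ?thesis
          using pochhammer_product'[of "1/2::real" "2 * m" k] by (simp only:) (simp add: add.commute)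
      qed
      have "f (m, n - m) = inv_sqrt_coeff (2 * m) * inv_sqrt_coeff m ^ 2 * (4 ^ m * y ^ m) * (pochhammer (2 * real m + 1/2) k / fact k) * ((- 1) ^ k * y ^ k)"
        by (simp add: f_def b_def q_def n power_mult_distrib power_minus[of y])
      also have "\<dots> = pochhammer (1/2) (2 * m) * pochhammer (2 * real m + 1/2) k * inv_sqrt_coeff m
                    * (inv_sqrt_coeff m * 4 ^ m / fact (2 * m)) / fact k * ((- 1) ^ k * y ^ (m + k))"
        by (simp add: inv_sqrt_coeff_def[of "2 * m"] power2_eq_square power_add)
      also have "inv_sqrt_coeff m * 4 ^ m / fact (2 * m) = 1 / (fact m)\<^sup>2"
        unfolding inv_sqrt_coeff_def pochhammer_half_double by (simp add: power2_eq_square)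
      also have "(- 1 :: real) ^ k = (- 1) ^ (m + k) * (- 1) ^ m"
        by (simp add: power_add)
      also have "pochhammer (1/2) (2 * m) * pochhammer (2 * real m + 1/2) k * inv_sqrt_coeff m
                    * (1 / (fact m)\<^sup>2) / fact k * ((- 1) ^ (m + k) * (- 1) ^ m * y ^ (m + k))
                 = (- y) ^ n * saalschuetz_term n m"
        unfolding saalschuetz_term_def p power_minus[of y n] by (simp add: n)
      finally show ?thesis .
    qed
    then have "(\<Sum>m\<le>n. f (m, n - m)) = (\<Sum>m\<le>n. (- y) ^ n * saalschuetz_term n m)"
      by (intro sum.cong) auto
    then show ?thesis by (simp add: saalschuetz_sum flip: sum_distrib_left)
  qed
  have hs3: "((\<lambda>n. inv_sqrt_coeff n ^ 3 * (- y) ^ n) has_sum tot) UNIV"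
  proof (rule has_sum_SigmaD[OF hs2])
    show "((\<lambda>m. case (n, m) of (n, m) \<Rightarrow> f (m, n - m)) has_sum inv_sqrt_coeff n ^ 3 * (- y) ^ n) {..n}" for n
      using has_sum_finite[of "{..n}" "\<lambda>m. f (m, n - m)"] by (simp add: diag)
  qed
  show "(\<lambda>m. inv_sqrt_coeff (2 * m) * inv_sqrt_coeff m ^ 2 * (4 * y) ^ m * (1 + y) powr (- (2 * real m + 1/2))) sums
           (\<Sum>n. inv_sqrt_coeff n ^ 3 * (- y) ^ n)"
    using has_sum_imp_sums[OF hs1] has_sum_imp_sums[OF hs3] by (auto simp: b_def sums_iff)
qed

section \<open>Double integrals of power series in products\<close>

lemma integral_power_series:
  fixes c :: "nat \<Rightarrow> real" and v :: "real \<Rightarrow> real"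
  assumes c: "summable (\<lambda>n. \<bar>c n\<bar>)"
    and v: "continuous_on {a..b} v" "\<And>y. y \<in> {a..b} \<Longrightarrow> \<bar>v y\<bar> \<le> 1"
  shows "(\<lambda>n. c n * integral {a..b} (\<lambda>y. v y ^ n)) sums
           integral {a..b} (\<lambda>y. \<Sum>n. c n * v y ^ n)"
proof -
  have bound: "norm (c n * v y ^ n) \<le> \<bar>c n\<bar>" if "y \<in> {a..b}" for n y
    using mult_left_mono[OF power_le_one[OF _ v(2)[OF that], of n], of "\<bar>c n\<bar>"]
    by (simp add: abs_mult power_abs)
  have lim: "uniform_limit {a..b} (\<lambda>N y. \<Sum>n<N. c n * v y ^ n) (\<lambda>y. \<Sum>n. c n * v y ^ n) sequentially"
    by (rule Weierstrass_m_test[OF bound c])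
  obtain I J where I: "\<And>N. ((\<lambda>y. \<Sum>n<N. c n * v y ^ n) has_integral I N) {a..b}"
    and J: "((\<lambda>y. \<Sum>n. c n * v y ^ n) has_integral J) {a..b}" and IJ: "I \<longlonglongrightarrow> J"
    by (rule uniform_limit_integral[OF lim]) (auto intro!: continuous_intros v)
  have "I N = (\<Sum>n<N. c n * integral {a..b} (\<lambda>y. v y ^ n))" for N
  proof -
    have "((\<lambda>y. \<Sum>n<N. c n * v y ^ n) has_integral (\<Sum>n<N. c n * integral {a..b} (\<lambda>y. v y ^ n))) {a..b}"
      by (intro has_integral_sum has_integral_mult_right integrable_integral
                integrable_continuous_real continuous_intros v) auto
    then show ?thesis using I has_integral_unique by blast
  qed
  then have "I = (\<lambda>N. \<Sum>n<N. c n * integral {a..b} (\<lambda>y. v y ^ n))"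
    by blast
  then show ?thesis
    using IJ integral_unique[OF J] by (simp add: sums_def)
qed

lemma integral_power_series_product:
  fixes c :: "nat \<Rightarrow> real" and u v :: "real \<Rightarrow> real"
  assumes c: "summable (\<lambda>n. \<bar>c n\<bar>)"
    and u: "continuous_on {a..b} u" "\<And>x. x \<in> {a..b} \<Longrightarrow> \<bar>u x\<bar> \<le> 1"
    and v: "continuous_on {a'..b'} v" "\<And>y. y \<in> {a'..b'} \<Longrightarrow> \<bar>v y\<bar> \<le> 1"
  shows "(\<lambda>n. c n * integral {a..b} (\<lambda>x. u x ^ n) * integral {a'..b'} (\<lambda>y. v y ^ n)) sums
           integral {a..b} (\<lambda>x. integral {a'..b'} (\<lambda>y. \<Sum>n. c n * (u x * v y) ^ n))"
proof -
  define V where "V n = integral {a'..b'} (\<lambda>y. v y ^ n)" for n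
  have inner: "(\<lambda>n. c n * V n * u x ^ n) sums integral {a'..b'} (\<lambda>y. \<Sum>n. c n * (u x * v y) ^ n)"
    if "x \<in> {a..b}" for x
  proof -
    have "\<bar>u x * v y\<bar> \<le> 1" if "y \<in> {a'..b'}" for y
      using mult_mono[OF u(2)[OF \<open>x \<in> {a..b}\<close>] v(2)[OF that]] by (simp add: abs_mult)
    then have "(\<lambda>n. c n * integral {a'..b'} (\<lambda>y. (u x * v y) ^ n)) sums
          integral {a'..b'} (\<lambda>y. \<Sum>n. c n * (u x * v y) ^ n)"
      by (intro integral_power_series[OF c]) (auto intro!: continuous_intros v)
    then show ?thesis
      by (simp add: power_mult_distrib V_def mult_ac)
  qed
  have "\<bar>V n\<bar> \<le> \<bar>b' - a'\<bar>" for n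
  proof (cases "a' \<le> b'")
    case True
    have "norm (V n) \<le> 1 * (b' - a')"
      unfolding V_def using True v
      by (intro integral_bound) (auto intro!: continuous_intros simp: power_abs power_le_one)
    then show ?thesis using True by simp
  qed (simp add: V_def)
  then have "summable (\<lambda>n. \<bar>c n * V n\<bar>)"
    by (intro summable_comparison_test'[where N = 0, OF summable_mult2[OF c, of "\<bar>b' - a'\<bar>"]])
       (simp add: abs_mult mult_left_mono)
  then have "(\<lambda>n. c n * V n * integral {a..b} (\<lambda>x. u x ^ n)) sums
               integral {a..b} (\<lambda>x. \<Sum>n. c n * V n * u x ^ n)"
    by (rule integral_power_series[OF _ u])
  also have "integral {a..b} (\<lambda>x. \<Sum>n. c n * V n * u x ^ n) =
        integral {a..b} (\<lambda>x. integral {a'..b'} (\<lambda>y. \<Sum>n. c n * (u x * v y) ^ n))"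
    using inner by (intro integral_cong) (simp add: sums_iff)
  finally show ?thesis by (simp add: V_def mult_ac)
qed

text \<open>
  Wallis' reduction. The hypothesis on \<open>b\<close> makes the boundary term vanish, which covers the
  quarter, half and full periods at once.
\<close>

lemma integral_cos_power_step:
  assumes "0 \<le> b" "sin b * cos b = 0"
  shows "integral {0..b} (\<lambda>x. cos x ^ (n + 2)) = (real n + 1) / (real n + 2) * integral {0..b} (\<lambda>x. cos x ^ n)"
proof -
  have ftc: "((\<lambda>x. (real n + 2) * cos x ^ (n + 2) - (real n + 1) * cos x ^ n)
          has_integral (sin b * cos b ^ (n + 1) - sin 0 * cos 0 ^ (n + 1))) {0..b}"
  proof (rule fundamental_theorem_of_calculus[OF \<open>0 \<le> b\<close>])
    fix x
    have "((\<lambda>x. sin x * cos x ^ (n + 1)) has_real_derivative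
           (cos x * cos x ^ (n + 1) - (real n + 1) * ((sin x)\<^sup>2 * cos x ^ n))) (at x within {0..b})"
      by (rule derivative_eq_intros refl)+ (simp add: power2_eq_square algebra_simps)
    also have "cos x * cos x ^ (n + 1) - (real n + 1) * ((sin x)\<^sup>2 * cos x ^ n)
                = (real n + 2) * cos x ^ (n + 2) - (real n + 1) * cos x ^ n"
    proof -
      have "(sin x)\<^sup>2 * cos x ^ n = cos x ^ n - cos x ^ (n + 2)"
        unfolding sin_squared_eq by (simp add: algebra_simps power2_eq_square)
      then show ?thesis
        by (simp only:) (simp add: algebra_simps)
    qed
    finally show "((\<lambda>x. sin x * cos x ^ (n + 1)) has_vector_derivative
           ((real n + 2) * cos x ^ (n + 2) - (real n + 1) * cos x ^ n)) (at x within {0..b})"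
      by (simp add: has_real_derivative_iff_has_vector_derivative)
  qed
  have lin: "((\<lambda>x. (real n + 2) * cos x ^ (n + 2) - (real n + 1) * cos x ^ n) has_integral
       ((real n + 2) * integral {0..b} (\<lambda>x. cos x ^ (n + 2)) - (real n + 1) * integral {0..b} (\<lambda>x. cos x ^ n))) {0..b}"
    by (intro has_integral_diff has_integral_mult_right integrable_integral
              integrable_continuous_real continuous_intros)
  have "sin b * cos b ^ (n + 1) = 0"
    using assms by auto
  then have "(real n + 2) * integral {0..b} (\<lambda>x. cos x ^ (n + 2)) - (real n + 1) * integral {0..b} (\<lambda>x. cos x ^ n) = 0"
    using has_integral_unique[OF lin ftc] by simp
  then show ?thesis by (simp add: eq_divide_eq mult.commute)
qed

lemma integral_cos_power_even:
  assumes "0 \<le> b" "sin b * cos b = 0"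
  shows "integral {0..b} (\<lambda>x. cos x ^ (2 * m)) = b * inv_sqrt_coeff m"
proof (induction m)
  case (Suc m)
  have "integral {0..b} (\<lambda>x. cos x ^ (2 * Suc m)) = (real (2 * m) + 1) / (real (2 * m) + 2) * (b * inv_sqrt_coeff m)"
    using integral_cos_power_step[OF assms, of "2 * m"] Suc by simp
  then show ?case by (simp add: inv_sqrt_coeff_Suc divide_simps)
qed (use assms in simp)

lemma integral_cos_power_odd: "integral {0..pi} (\<lambda>x. cos x ^ (2 * m + 1)) = 0"
proof (induction m)
  case 0
  have "(cos has_integral (sin pi - sin 0)) {0..pi}"
    by (intro fundamental_theorem_of_calculus)
       (auto intro!: derivative_eq_intros simp: has_real_derivative_iff_has_vector_derivative[symmetric])
  then show ?case by (simp add: integral_unique)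
next
  case (Suc m)
  then show ?case
    using integral_cos_power_step[of pi "2 * m + 1"] by simp
qed

section \<open>The two double integrals with the same series\<close>

text \<open>
  Odd powers of \<open>cos \<psi>\<close> integrate to zero over the half period and even ones by Wallis, which gives
  the left-hand series of the quadratic transformation at \<open>y = h\<^sup>2\<close>. In terms of Legendre polynomials,
  the identity expresses that \<open>P_n (cos \<theta> cos \<psi>)\<close> has mean \<open>P_n(0)^3\<close>.
\<close>

lemma integral_distance_series:
  fixes h :: real
  assumes h: "0 \<le> h" "h < 1" "2 * h < 1 - h\<^sup>2"
  shows "integral {0..pi/2} (\<lambda>\<theta>. integral {0..pi} (\<lambda>\<psi>. 1 / sqrt (1 + h\<^sup>2 - 2 * h * (cos \<theta> * cos \<psi>))))
           = pi\<^sup>2 / 2 * (\<Sum>n. inv_sqrt_coeff n ^ 3 * (- (h\<^sup>2)) ^ n)"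
proof -
  define y where "y = h\<^sup>2"
  have y: "0 \<le> y" "y < 1" "4 * y < (1 - y)\<^sup>2"
    using h power_strict_mono[OF h(3), of 2]
    by (auto simp: y_def power_mult_distrib power_less_one_iff abs_square_less_1)
  define r where "r = 2 * h / (1 + y)"
  have "0 \<le> r" using h by (simp add: r_def y_def)
  moreover have "r < 1"
  proof -
    have "2 * h < 1 + y" "0 < 1 + y" using h(3) y unfolding y_def by linarith+
    then show ?thesis by (simp add: r_def)
  qed
  ultimately have r: "\<bar>r\<bar> < 1" by simp
  define c where "c n = inv_sqrt_coeff n * r ^ n * (1 / sqrt (1 + y))" for n
  have c: "summable (\<lambda>n. \<bar>c n\<bar>)"
    unfolding c_def abs_mult[of _ "1 / _"] by (intro summable_mult2 summable_inv_sqrt_coeff_power r)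
  have expand: "(\<Sum>n. c n * t ^ n) = 1 / sqrt (1 + h\<^sup>2 - 2 * h * t)" if "\<bar>t\<bar> \<le> 1" for t
  proof -
    have "\<bar>r * t\<bar> < 1"
      using mult_left_le[OF that, of "\<bar>r\<bar>"] r by (simp add: abs_mult)
    then have "(\<lambda>n. inv_sqrt_coeff n * (r * t) ^ n * (1 / sqrt (1 + y))) sums (1 / sqrt (1 - r * t) * (1 / sqrt (1 + y)))"
      by (intro sums_mult2 inverse_sqrt_sums)
    also have "1 / sqrt (1 - r * t) * (1 / sqrt (1 + y)) = 1 / sqrt ((1 + y) * (1 - r * t))"
      by (simp add: real_sqrt_mult)
    also have "(1 + y) * (1 - r * t) = 1 + h\<^sup>2 - 2 * h * t"
    proof -
      have "1 + y > 0" using y by simp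
      then have "(1 + y) * r = 2 * h" by (simp add: r_def)
      then show ?thesis
        by (simp only: right_diff_distrib mult.assoc[symmetric]) (simp add: y_def)
    qed
    finally show ?thesis
      by (simp add: c_def power_mult_distrib mult_ac sums_iff)
  qed
  have "(\<lambda>n. c n * integral {0..pi/2} (\<lambda>\<theta>. cos \<theta> ^ n) * integral {0..pi} (\<lambda>\<psi>. cos \<psi> ^ n)) sums
      integral {0..pi/2} (\<lambda>\<theta>. integral {0..pi} (\<lambda>\<psi>. \<Sum>n. c n * (cos \<theta> * cos \<psi>) ^ n))"
    by (intro integral_power_series_product[OF c] continuous_intros) auto
  note series = this
  have integrand: "(\<Sum>n. c n * (cos \<theta> * cos \<psi>) ^ n) = 1 / sqrt (1 + h\<^sup>2 - 2 * h * (cos \<theta> * cos \<psi>))" for \<theta> \<psi>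
    using mult_mono[OF abs_cos_le_one[of \<theta>] abs_cos_le_one[of \<psi>]] by (intro expand) (simp add: abs_mult)
  have "(\<lambda>n. c n * integral {0..pi/2} (\<lambda>\<theta>. cos \<theta> ^ n) * integral {0..pi} (\<lambda>\<psi>. cos \<psi> ^ n)) sums
      integral {0..pi/2} (\<lambda>\<theta>. integral {0..pi} (\<lambda>\<psi>. 1 / sqrt (1 + h\<^sup>2 - 2 * h * (cos \<theta> * cos \<psi>))))"
    (is "?s sums ?I")
    using series unfolding integrand .
  moreover have "?s n = 0" if "n \<notin> range (\<lambda>m. 2 * m)" for n
  proof -
    have "odd n" using that by (auto elim!: evenE)
    then obtain m where "n = 2 * m + 1" by (elim oddE)
    then show ?thesis using integral_cos_power_odd[of m] by simp
  qed
  ultimately have "(\<lambda>m. ?s (2 * m)) sums ?I"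
    by (subst sums_mono_reindex) (auto simp: strict_mono_def)
  moreover have "?s (2 * m) = pi\<^sup>2 / 2 * (inv_sqrt_coeff (2 * m) * inv_sqrt_coeff m ^ 2 * (4 * y) ^ m * (1 + y) powr (- (2 * real m + 1/2)))" for m
  proof -
    have "(1 + y) powr (- (2 * real m + 1/2)) = (1 + y) powr (- (1/2) - real (2 * m))"
      by (rule arg_cong[where f = "\<lambda>e. (1 + y) powr e"]) simp
    also have "\<dots> = 1 / sqrt (1 + y) / (1 + y) ^ (2 * m)"
      using y powr_minus_divide[of "1 + y" "1/2"] powr_half_sqrt[of "1 + y"]
      by (subst powr_diff, subst powr_realpow) auto
    finally have e: "(1 + y) powr (- (2 * real m + 1/2)) = 1 / sqrt (1 + y) / (1 + y) ^ (2 * m)" .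
    have p: "r ^ (2 * m) = (4 * y) ^ m / (1 + y) ^ (2 * m)"
      by (simp add: r_def power_divide power_mult y_def power_mult_distrib)
    have i1: "integral {0..pi/2} (\<lambda>\<theta>. cos \<theta> ^ (2 * m)) = pi / 2 * inv_sqrt_coeff m"
      by (intro integral_cos_power_even) auto
    have i2: "integral {0..pi} (\<lambda>\<theta>. cos \<theta> ^ (2 * m)) = pi * inv_sqrt_coeff m"
      by (intro integral_cos_power_even) auto
    show ?thesis
      unfolding i1 i2 c_def p e by (simp add: power2_eq_square mult_ac)
  qed
  ultimately have "(\<lambda>m. pi\<^sup>2 / 2 * (inv_sqrt_coeff (2 * m) * inv_sqrt_coeff m ^ 2 * (4 * y) ^ m * (1 + y) powr (- (2 * real m + 1/2)))) sums ?I"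
    by (simp only:)
  moreover have "(\<lambda>m. pi\<^sup>2 / 2 * (inv_sqrt_coeff (2 * m) * inv_sqrt_coeff m ^ 2 * (4 * y) ^ m * (1 + y) powr (- (2 * real m + 1/2)))) sums
          (pi\<^sup>2 / 2 * (\<Sum>n. inv_sqrt_coeff n ^ 3 * (- y) ^ n))"
    by (intro sums_mult double_series_identity y)
  ultimately show ?thesis
    unfolding y_def using sums_unique2 by blast
qed

lemma integral_half_angle:
  fixes f :: "real \<Rightarrow> real"
  assumes "continuous_on {0..pi} f"
  shows "integral {0..2*pi} (\<lambda>x. f (x / 2)) = 2 * integral {0..pi} f"
proof -
  have "((\<lambda>x. (1/2) *\<^sub>R f (x / 2)) has_integral (integral {0/2..2*pi/2} f)) {0..2*pi}"
    by (rule has_integral_substitution[where c = 0 and d = pi])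
       (use assms in \<open>auto intro!: derivative_eq_intros\<close>)
  then have "((\<lambda>x. 2 * ((1/2) * f (x / 2))) has_integral (2 * integral {0..pi} f)) {0..2*pi}"
    by (intro has_integral_mult_right) simp
  then show ?thesis by (simp add: integral_unique)
qed

text \<open>
  The angle \<open>\<phi>/2\<close> instead of \<open>\<phi>\<close> changes nothing for the mean; it is the form in which the product
  formula produces this integral.
\<close>

lemma integral_torus_series:
  assumes "0 \<le> y" "y < 1"
  shows "integral {0..2*pi} (\<lambda>\<phi>. integral {0..2*pi} (\<lambda>\<psi>. 1 / sqrt (1 + y * ((cos (\<phi>/2))\<^sup>2 * (cos \<psi>)\<^sup>2))))
           = 4 * pi\<^sup>2 * (\<Sum>n. inv_sqrt_coeff n ^ 3 * (- y) ^ n)"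
proof -
  define c where "c n = inv_sqrt_coeff n * (- y) ^ n" for n
  have "(\<lambda>n. c n * integral {0..2*pi} (\<lambda>\<phi>. ((cos (\<phi>/2))\<^sup>2) ^ n) * integral {0..2*pi} (\<lambda>\<psi>. ((cos \<psi>)\<^sup>2) ^ n)) sums
     integral {0..2*pi} (\<lambda>\<phi>. integral {0..2*pi} (\<lambda>\<psi>. \<Sum>n. c n * ((cos (\<phi>/2))\<^sup>2 * (cos \<psi>)\<^sup>2) ^ n))"
    unfolding c_def using assms
    by (intro integral_power_series_product summable_inv_sqrt_coeff_power continuous_intros)
       (auto simp: abs_square_le_1)
  note series = this
  have integrand: "(\<Sum>n. c n * ((cos (\<phi>/2))\<^sup>2 * (cos \<psi>)\<^sup>2) ^ n) = 1 / sqrt (1 + y * ((cos (\<phi>/2))\<^sup>2 * (cos \<psi>)\<^sup>2))" for \<phi> \<psi>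
  proof -
    define t where "t = (cos (\<phi>/2))\<^sup>2 * (cos \<psi>)\<^sup>2"
    have t: "0 \<le> t" "t \<le> 1"
      using mult_mono[of "(cos (\<phi>/2))\<^sup>2" 1 "(cos \<psi>)\<^sup>2" 1] by (auto simp: t_def abs_square_le_1)
    have "\<bar>- y * t\<bar> < 1"
      using assms t mult_left_le[of t y] by (simp add: abs_mult)
    from inverse_sqrt_sums[OF this] show ?thesis
      unfolding t_def[symmetric] c_def by (simp add: sums_iff power_mult_distrib[symmetric] mult.assoc)
  qed
  have moment1: "integral {0..2*pi} (\<lambda>\<phi>. ((cos (\<phi>/2))\<^sup>2) ^ n) = 2 * pi * inv_sqrt_coeff n" for n
  proof -
    have "integral {0..2*pi} (\<lambda>\<phi>. ((cos (\<phi>/2))\<^sup>2) ^ n) = 2 * integral {0..pi} (\<lambda>\<phi>. ((cos \<phi>)\<^sup>2) ^ n)"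
      by (rule integral_half_angle) (intro continuous_intros)
    also have "integral {0..pi} (\<lambda>\<phi>. ((cos \<phi>)\<^sup>2) ^ n) = pi * inv_sqrt_coeff n"
      unfolding power_mult[symmetric] by (intro integral_cos_power_even) auto
    finally show ?thesis by simp
  qed
  have moment2: "integral {0..2*pi} (\<lambda>\<phi>. ((cos \<phi>)\<^sup>2) ^ n) = 2 * pi * inv_sqrt_coeff n" for n
    unfolding power_mult[symmetric] by (intro integral_cos_power_even) auto
  have "(\<lambda>n. 4 * pi\<^sup>2 * (inv_sqrt_coeff n ^ 3 * (- y) ^ n)) sums
     integral {0..2*pi} (\<lambda>\<phi>. integral {0..2*pi} (\<lambda>\<psi>. 1 / sqrt (1 + y * ((cos (\<phi>/2))\<^sup>2 * (cos \<psi>)\<^sup>2))))"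
    using series unfolding integrand moment1 moment2
    by (simp add: c_def power2_eq_square power3_eq_cube mult_ac)
  then have s: "summable (\<lambda>n. 4 * pi\<^sup>2 * (inv_sqrt_coeff n ^ 3 * (- y) ^ n))" 
    and e: "(\<Sum>n. 4 * pi\<^sup>2 * (inv_sqrt_coeff n ^ 3 * (- y) ^ n)) = integral {0..2*pi} (\<lambda>\<phi>. integral {0..2*pi} (\<lambda>\<psi>. 1 / sqrt (1 + y * ((cos (\<phi>/2))\<^sup>2 * (cos \<psi>)\<^sup>2))))"
    by (simp_all add: sums_iff)
  have "summable (\<lambda>n. inv_sqrt_coeff n ^ 3 * (- y) ^ n)"
    using summable_mult[OF s, of "1 / (4 * pi\<^sup>2)"] by simp
  from suminf_mult[OF this, of "4 * pi\<^sup>2"] show ?thesis unfolding e by simp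
qed

section \<open>Landen's transformation\<close>

lemma integral_periodic_shift:
  fixes f :: "real \<Rightarrow> real"
  assumes f: "continuous_on UNIV f" and per: "\<And>x. f (x + p) = f x" and a: "0 \<le> a" "a \<le> p"
  shows "integral {0..p} (\<lambda>x. f (x + a)) = integral {0..p} f"
proof -
  have int: "f integrable_on {u..v}" for u v
    using f by (intro integrable_continuous_real) (auto intro: continuous_on_subset)
  have shift: "integral {u..v} (\<lambda>x. f (x + c)) = integral {u + c..v + c} f" for u v c
    using integral_shift[of u c v f] f continuous_on_subset by (auto simp: o_def)
  have "integral {0..p} (\<lambda>x. f (x + a)) = integral {a..p + a} f"
    by (simp add: shift)
  also have "\<dots> = integral {a..p} f + integral {p..p + a} f"
    using a int by (intro Henstock_Kurzweil_Integration.integral_combine[symmetric]) auto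
  also have "integral {p..p + a} f = integral {0..a} f"
    using shift[of 0 a p] per by (simp add: add.commute)
  also have "integral {a..p} f + integral {0..a} f = integral {0..p} f"
    using a int Henstock_Kurzweil_Integration.integral_combine[of 0 a p f] by simp
  finally show ?thesis .
qed

lemma abs_mult_cos_le: "\<bar>q * cos x\<bar> \<le> \<bar>q\<bar>" for q x :: real
  by (simp add: abs_mult mult_left_le)

text \<open>
  A linear form in \<open>cos x\<close> and \<open>sin x\<close> is a shifted cosine, and a shift does not affect the integral
  over a period.
\<close>

lemma integral_rotate:
  fixes f :: "real \<Rightarrow> real"
  assumes f: "continuous_on {-\<bar>q\<bar>..\<bar>q\<bar>} f" and q: "A\<^sup>2 + B\<^sup>2 = q\<^sup>2"
  shows "integral {0..2*pi} (\<lambda>x. f (A * cos x + B * sin x)) = integral {0..2*pi} (\<lambda>x. f (q * cos x))"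
proof (cases "q = 0")
  case True
  with q have "A = 0" "B = 0" by (auto simp: sum_power2_eq_zero_iff)
  with True show ?thesis by simp
next
  case False
  then have "(A / q)\<^sup>2 + (- B / q)\<^sup>2 = 1"
    using q by (simp add: power_divide add_divide_distrib[symmetric])
  then obtain a where a: "0 \<le> a" "a < 2 * pi" "A / q = cos a" "- B / q = sin a"
    by (elim sincos_total_2pi)
  then have AB: "A = q * cos a" "B = - q * sin a"
    using False by (auto simp: field_simps)
  have "- \<bar>q\<bar> \<le> q * cos x \<and> q * cos x \<le> \<bar>q\<bar>" for x
    using abs_mult_cos_le[of q x] by linarith
  then have "continuous_on UNIV (\<lambda>x. f (q * cos x))"
    by (intro continuous_on_compose2[OF f] continuous_intros) auto
  from integral_periodic_shift[OF this, of "2 * pi" a] a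
  have "integral {0..2*pi} (\<lambda>x. f (q * cos (x + a))) = integral {0..2*pi} (\<lambda>x. f (q * cos x))"
    by simp
  then show ?thesis by (simp add: AB cos_add algebra_simps)
qed

text \<open>
  Landen's angle: \<open>\<psi>\<close> is defined by \<open>sin (x - \<psi>) = r sin x\<close>. In the triangle with sides 1 and \<open>r\<close>
  enclosing the angle \<open>\<psi>\<close>, the third side is \<open>sqrt (1 - r\<^sup>2 sin\<^sup>2 x) - r cos x\<close>; this is also
  the numerator of \<open>d\<psi>/dx\<close>, whose denominator \<open>sqrt (1 - r\<^sup>2 sin\<^sup>2 x)\<close> is what remains.
\<close>

lemma landen:
  fixes r :: real
  assumes r: "\<bar>r\<bar> < 1"
  shows "integral {0..2*pi} (\<lambda>\<psi>. 1 / sqrt (1 + r\<^sup>2 - 2 * r * cos \<psi>))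
       = integral {0..2*pi} (\<lambda>x. 1 / sqrt (1 - (r * sin x)\<^sup>2))"
proof -
  define f where "f = (\<lambda>\<psi>. 1 / sqrt (1 + r\<^sup>2 - 2 * r * cos \<psi>))"
  define g where "g = (\<lambda>x. x - arcsin (r * sin x))"
  define D where "D = (\<lambda>x. sqrt (1 - (r * sin x)\<^sup>2))"
  have rs: "\<bar>r * sin x\<bar> < 1" for x
    using r mult_left_le[of "\<bar>sin x\<bar>" "\<bar>r\<bar>"] by (simp add: abs_mult)
  have Dpos: "D x > 0" for x
    using rs[of x] by (simp add: D_def abs_square_less_1)
  have D2: "(D x)\<^sup>2 = 1 - (r * sin x)\<^sup>2" for x
    using rs[of x] by (simp add: D_def abs_square_le_1 less_imp_le)
  have pos: "1 + r\<^sup>2 - 2 * r * cos x > 0" for x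
  proof -
    have "2 * r * cos x \<le> 2 * \<bar>r\<bar>"
      using abs_mult_cos_le[of r x] by linarith
    moreover have "(1 - \<bar>r\<bar>)\<^sup>2 > 0" using r by simp
    then have "1 + r\<^sup>2 - 2 * \<bar>r\<bar> > 0" by (simp add: power2_diff)
    ultimately show ?thesis by linarith
  qed
  have deriv: "(g has_field_derivative (1 - r * cos x / D x)) (at x within S)" for x S
    unfolding g_def D_def using rs[of x]
    by (auto intro!: derivative_eq_intros simp: abs_less_iff divide_inverse)
  \<comment> \<open>the radicand becomes a perfect square under the substitution\<close>
  have fg: "(1 - r * cos x / D x) *\<^sub>R f (g x) = 1 / D x" for x
  proof -
    have "cos (g x) = cos x * D x + sin x * (r * sin x)"
      using rs[of x] by (simp add: g_def cos_diff cos_arcsin D_def abs_less_iff)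
    then have "1 + r\<^sup>2 - 2 * r * cos (g x) = 1 + r\<^sup>2 - 2 * r * cos x * D x - 2 * (r * sin x)\<^sup>2"
      by (simp add: power2_eq_square algebra_simps)
    also have "\<dots> = (D x)\<^sup>2 - 2 * r * cos x * D x + (r * cos x)\<^sup>2"
      unfolding D2 power_mult_distrib cos_squared_eq by (simp add: algebra_simps)
    also have "\<dots> = (D x - r * cos x)\<^sup>2"
      by (simp add: power2_diff)
    finally have sq: "1 + r\<^sup>2 - 2 * r * cos (g x) = (D x - r * cos x)\<^sup>2" .
    have "(r * cos x)\<^sup>2 < (D x)\<^sup>2"
      unfolding D2 power_mult_distrib cos_squared_eq using r
      by (simp add: algebra_simps abs_square_less_1)
    then have "r * cos x < D x"
      using Dpos[of x] by (meson power2_less_imp_less less_imp_le)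
    then show ?thesis
      using Dpos[of x] unfolding f_def sq by (simp add: divide_simps)
  qed
  have "continuous_on UNIV f"
    unfolding f_def using pos by (auto intro!: continuous_intros simp: less_imp_neq[symmetric] less_imp_le)
  moreover have "continuous_on {0..2*pi} g"
    by (rule DERIV_continuous_on[OF deriv])
  then have "bounded (g ` {0..2*pi})"
    by (intro compact_imp_bounded compact_continuous_image) auto
  then obtain M where M: "\<forall>x\<in>{0..2*pi}. norm (g x) \<le> M"
    unfolding bounded_iff by blast
  moreover have "g 0 = 0" "g (2 * pi) = 2 * pi" by (simp_all add: g_def)
  ultimately have "((\<lambda>x. (1 - r * cos x / D x) *\<^sub>R f (g x)) has_integral (integral {g 0..g (2*pi)} f)) {0..2*pi}"
    using M by (intro has_integral_substitution[where c = "-M" and d = M])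
       (auto intro!: deriv intro: continuous_on_subset simp: abs_le_iff minus_le_iff)
  then show ?thesis
    unfolding fg by (simp add: g_def f_def D_def integral_unique)
qed

text \<open>
  The preceding transformation at \<open>r = - s / sqrt (1 + s\<^sup>2)\<close>, after scaling. The two coefficients on the
  left are a hyperbolic cosine and the matching hyperbolic sine, as they arise from the product
  formula.
\<close>

lemma landen_cosh:
  fixes s :: real
  shows "integral {0..2*pi} (\<lambda>\<psi>. 1 / sqrt (1 + 2 * s\<^sup>2 + 2 * s * sqrt (1 + s\<^sup>2) * cos \<psi>))
       = integral {0..2*pi} (\<lambda>x. 1 / sqrt (1 + s\<^sup>2 * (cos x)\<^sup>2))"
proof -
  define w where "w = sqrt (1 + s\<^sup>2)"
  have w: "w > 0" "w\<^sup>2 = 1 + s\<^sup>2" by (auto simp: w_def add_pos_nonneg)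
  define r where "r = - s / w"
  have "\<bar>s\<bar> < w" unfolding w_def by (rule real_less_rsqrt) simp
  then have r: "\<bar>r\<bar> < 1" using w by (simp add: r_def)
  have rw: "r * w = - s" using w by (simp add: r_def)
  have e1: "1 + 2 * s\<^sup>2 + 2 * s * w * cos \<psi> = w\<^sup>2 * (1 + r\<^sup>2 - 2 * r * cos \<psi>)" for \<psi>
  proof -
    have "w\<^sup>2 * (1 + r\<^sup>2 - 2 * r * cos \<psi>) = w\<^sup>2 + (r * w)\<^sup>2 - 2 * (r * w) * w * cos \<psi>"
      by (simp add: power2_eq_square algebra_simps)
    then show ?thesis unfolding rw w(2) by simp
  qed
  have e2: "w\<^sup>2 * (1 - (r * sin x)\<^sup>2) = 1 + s\<^sup>2 * (cos x)\<^sup>2" for x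
  proof -
    have "w\<^sup>2 * (1 - (r * sin x)\<^sup>2) = w\<^sup>2 - (r * w)\<^sup>2 * (sin x)\<^sup>2"
      by (simp add: power2_eq_square algebra_simps)
    then show ?thesis unfolding rw w(2) cos_squared_eq by (simp add: algebra_simps)
  qed
  have "integral {0..2*pi} (\<lambda>\<psi>. 1 / sqrt (1 + 2 * s\<^sup>2 + 2 * s * w * cos \<psi>))
     = 1 / w * integral {0..2*pi} (\<lambda>\<psi>. 1 / sqrt (1 + r\<^sup>2 - 2 * r * cos \<psi>))"
    unfolding e1 using w(1) by (simp add: real_sqrt_mult flip: integral_mult_right)
  also have "\<dots> = integral {0..2*pi} (\<lambda>x. 1 / sqrt (w\<^sup>2 * (1 - (r * sin x)\<^sup>2)))"
    unfolding landen[OF r] using w(1) by (simp add: real_sqrt_mult flip: integral_mult_right)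
  finally show ?thesis unfolding e2 unfolding w_def .
qed

section \<open>The product formula\<close>

text \<open>
  With \<open>c = cosh \<alpha>\<close> and \<open>s = sinh \<alpha>\<close> the integral on the right is \<open>2 \<pi>\<close> times the spherical function
  \<open>\<Phi>(\<alpha>)\<close> of degree -1/2 on the hyperbolic plane. Let \<open>T \<phi> \<psi>\<close> be the time component of the null vector
  \<open>(1, cos \<psi>, sin \<psi>)\<close> after a boost by \<open>\<alpha>\<close>, a rotation by \<open>\<phi>\<close> and another boost by \<open>\<alpha>\<close>. The first
  boost scales the null vector by \<open>c + s cos \<psi>\<close> and moves its direction; the rotation averages the
  direction out, so integrating \<open>1 / sqrt T\<close> over \<open>\<phi>\<close> first yields the product. Integrating over \<open>\<psi>\<close>
  first yields the spherical function at the distance whose hyperbolic cosine is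
  \<open>c\<^sup>2 + s\<^sup>2 cos \<phi> = 1 + 2 s\<^sup>2 cos\<^sup>2 (\<phi>/2)\<close>, to which Landen's transformation applies.
\<close>

lemma legendre_product_formula:
  fixes s c :: real
  assumes c: "c > 0" "c\<^sup>2 = 1 + s\<^sup>2"
  shows "integral {0..2*pi} (\<lambda>\<phi>. integral {0..2*pi} (\<lambda>\<psi>. 1 / sqrt (1 + s\<^sup>2 * ((cos (\<phi>/2))\<^sup>2 * (cos \<psi>)\<^sup>2))))
       = (integral {0..2*pi} (\<lambda>\<psi>. 1 / sqrt (c + s * cos \<psi>)))\<^sup>2"
proof -
  define T where "T \<phi> \<psi> = (c\<^sup>2 + s\<^sup>2 * cos \<phi>) + (c * s * (1 + cos \<phi>) * cos \<psi> + (- s * sin \<phi>) * sin \<psi>)" for \<phi> \<psi>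
  have "\<bar>s\<bar> < c"
    using c by (intro power2_less_imp_less[of "\<bar>s\<bar>" c]) auto
  then have pos: "c + s * cos x > 0" for x
    using abs_mult_cos_le[of s x] by linarith
  define L where "L \<psi> = c + s * cos \<psi>" for \<psi>
  have cs: "(s + c * cos \<psi>)\<^sup>2 + (- sin \<psi>)\<^sup>2 = (L \<psi>)\<^sup>2" for \<psi>
  proof -
    have "(s + c * cos \<psi>)\<^sup>2 + (- sin \<psi>)\<^sup>2 - (L \<psi>)\<^sup>2 = (c\<^sup>2 - s\<^sup>2 - 1) * ((cos \<psi>)\<^sup>2 - 1)"
      unfolding power2_minus sin_squared_eq L_def by (simp add: power2_eq_square algebra_simps)
    then show ?thesis using c by simp
  qed
  \<comment> \<open>the same quantity as a linear form in \<open>cos \<phi>\<close> and \<open>sin \<phi>\<close>, of amplitude \<open>s * L \<psi>\<close> by \<open>cs\<close>\<close>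
  have T2: "T \<phi> \<psi> = c * L \<psi> + s * ((s + c * cos \<psi>) * cos \<phi> + (- sin \<psi>) * sin \<phi>)" for \<phi> \<psi>
    by (simp add: T_def L_def power2_eq_square algebra_simps)
  have cauchy_schwarz: "(a * x + b * y)\<^sup>2 \<le> (a\<^sup>2 + b\<^sup>2) * (x\<^sup>2 + y\<^sup>2)" for a b x y :: real
    using zero_le_power2[of "a * y - b * x"] by (simp add: power2_eq_square algebra_simps)
  have Tpos: "T \<phi> \<psi> > 0" for \<phi> \<psi>
  proof -
    have "\<bar>(s + c * cos \<psi>) * cos \<phi> + (- sin \<psi>) * sin \<phi>\<bar> \<le> L \<psi>"
    proof (rule power2_le_imp_le)
      have "((s + c * cos \<psi>) * cos \<phi> + (- sin \<psi>) * sin \<phi>)\<^sup>2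
        \<le> ((s + c * cos \<psi>)\<^sup>2 + (- sin \<psi>)\<^sup>2) * ((cos \<phi>)\<^sup>2 + (sin \<phi>)\<^sup>2)"
        by (rule cauchy_schwarz)
      then show "\<bar>(s + c * cos \<psi>) * cos \<phi> + (- sin \<psi>) * sin \<phi>\<bar>\<^sup>2 \<le> (L \<psi>)\<^sup>2"
        unfolding cs by simp
    qed (use pos in \<open>simp add: L_def less_imp_le\<close>)
    then have "\<bar>s * ((s + c * cos \<psi>) * cos \<phi> + (- sin \<psi>) * sin \<phi>)\<bar> \<le> \<bar>s\<bar> * L \<psi>"
      unfolding abs_mult by (intro mult_left_mono) auto
    also have "\<dots> < c * L \<psi>"
      using \<open>\<bar>s\<bar> < c\<close> pos[of \<psi>] by (intro mult_strict_right_mono) (auto simp: L_def)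
    finally show ?thesis unfolding T2 by linarith
  qed
  have "integral {0..2*pi} (\<lambda>\<psi>. 1 / sqrt (T \<phi> \<psi>)) =
        integral {0..2*pi} (\<lambda>\<psi>. 1 / sqrt (1 + s\<^sup>2 * ((cos (\<phi>/2))\<^sup>2 * (cos \<psi>)\<^sup>2)))" for \<phi>
  proof -
    define \<sigma> where "\<sigma> = s * cos (\<phi> / 2)"
    define q where "q = 2 * \<sigma> * sqrt (1 + \<sigma>\<^sup>2)"
    have half: "s\<^sup>2 * (1 + cos \<phi>) = 2 * \<sigma>\<^sup>2"
      using cos_double_cos[of "\<phi> / 2"] by (simp add: \<sigma>_def power_mult_distrib)
    have p: "c\<^sup>2 + s\<^sup>2 * cos \<phi> = 1 + 2 * \<sigma>\<^sup>2"
      using half c by (simp add: algebra_simps)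
    have "(c * s * (1 + cos \<phi>))\<^sup>2 + (- s * sin \<phi>)\<^sup>2
        = (s\<^sup>2 * (1 + cos \<phi>)) * (c\<^sup>2 * (1 + cos \<phi>) + (1 - cos \<phi>))"
      unfolding power_mult_distrib power2_minus sin_squared_eq by (simp add: power2_eq_square algebra_simps)
    also have "c\<^sup>2 * (1 + cos \<phi>) + (1 - cos \<phi>) = 2 + s\<^sup>2 * (1 + cos \<phi>)"
      unfolding c by (simp add: algebra_simps)
    also have "(s\<^sup>2 * (1 + cos \<phi>)) * (2 + s\<^sup>2 * (1 + cos \<phi>)) = q\<^sup>2"
      unfolding half q_def power_mult_distrib by (simp add: power2_eq_square algebra_simps)
    finally have q: "(c * s * (1 + cos \<phi>))\<^sup>2 + (- s * sin \<phi>)\<^sup>2 = q\<^sup>2" .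
    have q_bound: "\<bar>q\<bar> < 1 + 2 * \<sigma>\<^sup>2"
    proof (rule power2_less_imp_less)
      have "\<bar>q\<bar>\<^sup>2 = 4 * \<sigma>\<^sup>2 * (1 + \<sigma>\<^sup>2)" by (simp add: q_def power_mult_distrib)
      then show "\<bar>q\<bar>\<^sup>2 < (1 + 2 * \<sigma>\<^sup>2)\<^sup>2" by (simp add: power2_eq_square algebra_simps)
    qed simp
    have "integral {0..2*pi} (\<lambda>\<psi>. 1 / sqrt (T \<phi> \<psi>)) =
          integral {0..2*pi} (\<lambda>\<psi>. 1 / sqrt (1 + 2 * \<sigma>\<^sup>2 + q * cos \<psi>))"
      unfolding T_def p using q_bound
      by (intro integral_rotate[where f = "\<lambda>z. 1 / sqrt (1 + 2 * \<sigma>\<^sup>2 + z)", OF _ q] continuous_intros)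
         (auto simp: abs_less_iff)
    also have "\<dots> = integral {0..2*pi} (\<lambda>\<psi>. 1 / sqrt (1 + \<sigma>\<^sup>2 * (cos \<psi>)\<^sup>2))"
      unfolding q_def by (rule landen_cosh)
    finally show ?thesis by (simp add: \<sigma>_def power_mult_distrib mult.assoc)
  qed
  then have "integral {0..2*pi} (\<lambda>\<phi>. integral {0..2*pi} (\<lambda>\<psi>. 1 / sqrt (1 + s\<^sup>2 * ((cos (\<phi>/2))\<^sup>2 * (cos \<psi>)\<^sup>2))))
     = integral {0..2*pi} (\<lambda>\<phi>. integral {0..2*pi} (\<lambda>\<psi>. 1 / sqrt (T \<phi> \<psi>)))"
    by simp
  also have "\<dots> = integral {0..2*pi} (\<lambda>\<psi>. integral {0..2*pi} (\<lambda>\<phi>. 1 / sqrt (T \<phi> \<psi>)))"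
  proof -
    have "continuous_on (cbox (0, 0) (2*pi, 2*pi)) (\<lambda>(\<phi>, \<psi>). 1 / sqrt (T \<phi> \<psi>))"
      using Tpos unfolding case_prod_unfold T_def
      by (auto intro!: continuous_intros simp: less_imp_neq[symmetric])
    from integral_swap_continuous[OF this] show ?thesis by simp
  qed
  also have "(\<lambda>\<psi>. integral {0..2*pi} (\<lambda>\<phi>. 1 / sqrt (T \<phi> \<psi>))) =
     (\<lambda>\<psi>. 1 / sqrt (L \<psi>) * integral {0..2*pi} (\<lambda>\<phi>. 1 / sqrt (c + s * cos \<phi>)))"
  proof
    fix \<psi>
    have Lpos: "L \<psi> > 0" using pos by (simp add: L_def)
    have "c * L \<psi> + s * z \<noteq> 0" if "\<bar>z\<bar> \<le> L \<psi>" for z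
    proof -
      have "\<bar>s * z\<bar> \<le> \<bar>s\<bar> * L \<psi>" unfolding abs_mult using that by (intro mult_left_mono) auto
      also have "\<dots> < c * L \<psi>" using \<open>\<bar>s\<bar> < c\<close> Lpos by (rule mult_strict_right_mono)
      finally show ?thesis by linarith
    qed
    then have "integral {0..2*pi} (\<lambda>\<phi>. 1 / sqrt (T \<phi> \<psi>)) =
          integral {0..2*pi} (\<lambda>\<phi>. 1 / sqrt (c * L \<psi> + s * (L \<psi> * cos \<phi>)))"
      unfolding T2 using Lpos
      by (intro integral_rotate[where f = "\<lambda>z. 1 / sqrt (c * L \<psi> + s * z)", OF _ cs] continuous_intros)
         (auto simp: abs_le_iff minus_le_iff)
    also have "\<dots> = integral {0..2*pi} (\<lambda>\<phi>. 1 / sqrt (L \<psi> * (c + s * cos \<phi>)))"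
      by (simp add: algebra_simps)
    also have "\<dots> = 1 / sqrt (L \<psi>) * integral {0..2*pi} (\<lambda>\<phi>. 1 / sqrt (c + s * cos \<phi>))"
      by (simp add: real_sqrt_mult flip: integral_mult_right)
    finally show "integral {0..2*pi} (\<lambda>\<phi>. 1 / sqrt (T \<phi> \<psi>)) =
       1 / sqrt (L \<psi>) * integral {0..2*pi} (\<lambda>\<phi>. 1 / sqrt (c + s * cos \<phi>))" .
  qed
  also have "integral {0..2*pi} (\<lambda>\<psi>. 1 / sqrt (L \<psi>) * integral {0..2*pi} (\<lambda>\<phi>. 1 / sqrt (c + s * cos \<phi>)))
      = (integral {0..2*pi} (\<lambda>\<psi>. 1 / sqrt (c + s * cos \<psi>)))\<^sup>2"
    unfolding L_def power2_eq_square by (rule integral_mult_left)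
  finally show ?thesis .
qed

section \<open>The lemniscatic integral\<close>

text \<open>
  The substitution \<open>t = sin\<^sup>4 x\<close> turns the Beta integrand into this one. The Beta integrand is singular
  at both ends, so the change of variables is done for nonnegative measurable functions.
\<close>

lemma integral_one_plus_sin_squared:
  "integral {0..pi/2} (\<lambda>x. 1 / sqrt (1 + (sin x)\<^sup>2)) = Beta (1/4) (1/2) / 4"
proof -
  define f where "f = (\<lambda>t::real. t powr (-3/4) * (1 - t) powr (-1/2))"
  have "(f has_integral Beta (1/4) (1/2)) {0..1}"
    using has_integral_Beta_real[of "1/4" "1/2"] by (simp add: f_def)
  then have "ennreal (Beta (1/4) (1/2)) = (\<integral>\<^sup>+t. ennreal (f t) * indicator {0..1} t \<partial>lborel)"
    by (intro nn_integral_has_integral_lebesgue'[symmetric]) (auto simp: f_def)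
  also have "\<dots> = (\<integral>\<^sup>+t. ennreal (f t * indicator {(sin 0)^4..(sin (pi/2))^4} t) \<partial>lborel)"
    by (intro nn_integral_cong) (auto simp: indicator_def)
  also have "\<dots> = (\<integral>\<^sup>+x. ennreal (f ((sin x)^4) * (4 * sin x ^ 3 * cos x) * indicator {0..pi/2} x) \<partial>lborel)"
  proof (rule nn_integral_substitution)
    show "set_borel_measurable borel {(sin 0)^4..(sin (pi/2))^4} f"
      unfolding set_borel_measurable_def f_def by measurable
    show "((\<lambda>x. (sin x)^4) has_real_derivative 4 * sin x ^ 3 * cos x) (at x)" for x :: real
      by (auto intro!: derivative_eq_intros)
    show "continuous_on {0..pi/2} (\<lambda>x::real. 4 * sin x ^ 3 * cos x)"
      by (intro continuous_intros)
    show "4 * sin x ^ 3 * cos x \<ge> 0" if "x \<in> {0..pi/2}" for x :: real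
      using that by (intro mult_nonneg_nonneg zero_le_power sin_ge_zero cos_ge_zero) auto
  qed simp
  also have "\<dots> = (\<integral>\<^sup>+x. ennreal (4 * (1 / sqrt (1 + (sin x)\<^sup>2))) * indicator {0..pi/2} x \<partial>lborel)"
  proof (rule nn_integral_cong_AE)
    have "f ((sin x)^4) * (4 * sin x ^ 3 * cos x) = 4 * (1 / sqrt (1 + (sin x)\<^sup>2))"
      if "0 < x" "x < pi/2" for x :: real
    proof -
      have s: "sin x > 0" and c: "cos x > 0"
        using that by (auto intro!: sin_gt_zero cos_gt_zero)
      have "(sin x)^4 = sin x powr 4"
        using s by (simp add: powr_numeral)
      then have "((sin x)^4) powr (-3/4) = sin x powr (- 3)"
        by (simp add: powr_powr)
      also have "\<dots> = 1 / sin x ^ 3"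
        using s by (simp add: powr_minus_divide powr_numeral)
      finally have 1: "((sin x)^4) powr (-3/4) = 1 / sin x ^ 3" .
      have "1 - (sin x)^4 = (cos x)\<^sup>2 * (1 + (sin x)\<^sup>2)"
        unfolding cos_squared_eq by (simp add: algebra_simps power2_eq_square power4_eq_xxxx)
      moreover have "(1 - (sin x)^4) powr (-1/2) = 1 / sqrt (1 - (sin x)^4)"
        using powr_minus_divide[of "1 - (sin x)^4" "1/2"] powr_half_sqrt[of "1 - (sin x)^4"]
          power_le_one[of "sin x" 4] s by simp
      ultimately have 2: "(1 - (sin x)^4) powr (-1/2) = 1 / (cos x * sqrt (1 + (sin x)\<^sup>2))"
        using c by (simp add: real_sqrt_mult)
      show ?thesis
        unfolding f_def 1 2 using s c by simp
    qed
    note pointwise = this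
    show "AE x in lborel. ennreal (f ((sin x)^4) * (4 * sin x ^ 3 * cos x) * indicator {0..pi/2} x)
            = ennreal (4 * (1 / sqrt (1 + (sin x)\<^sup>2))) * indicator {0..pi/2} x"
      using AE_lborel_singleton[of 0] AE_lborel_singleton[of "pi/2"]
      by eventually_elim (use pointwise in \<open>auto simp: indicator_def\<close>)
  qed
  also have "\<dots> = ennreal (4 * integral {0..pi/2} (\<lambda>x. 1 / sqrt (1 + (sin x)\<^sup>2)))"
  proof (rule nn_integral_has_integral_lebesgue')
    have "1 + (sin x)\<^sup>2 \<noteq> 0" for x :: real
      using zero_le_power2[of "sin x"] by linarith
    then show "((\<lambda>x. 4 * (1 / sqrt (1 + (sin x)\<^sup>2))) has_integral
       4 * integral {0..pi/2} (\<lambda>x. 1 / sqrt (1 + (sin x)\<^sup>2))) {0..pi/2}"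
      by (intro has_integral_mult_right integrable_integral integrable_continuous_real continuous_intros) auto
  qed auto
  finally have "Beta (1/4) (1/2) = 4 * integral {0..pi/2} (\<lambda>x. 1 / sqrt (1 + (sin x)\<^sup>2))"
  proof (subst (asm) ennreal_inj)
    show "Beta (1/4) (1/2 :: real) \<ge> 0"
      unfolding Beta_def by (intro divide_nonneg_nonneg mult_nonneg_nonneg) (auto intro!: less_imp_le Gamma_real_pos)
    show "0 \<le> 4 * integral {0..pi/2} (\<lambda>x. 1 / sqrt (1 + (sin x)\<^sup>2))"
      by (intro mult_nonneg_nonneg Henstock_Kurzweil_Integration.integral_nonneg
                integrable_continuous_real continuous_intros)
         (auto simp: add_nonneg_eq_0_iff)
  qed
  then show ?thesis by simp
qed

lemma Beta_quarter_half_squared: "(Beta (1/4) (1/2 :: real))\<^sup>2 = Gamma (1/4) ^ 4 / (2 * pi)"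
proof -
  have "sin (pi * (1/4)) = 1 / sqrt 2"
    by (simp add: sin_45 real_div_sqrt divide_simps)
  moreover have "Gamma (1/4 :: real) * Gamma (3/4) = pi / sin (pi * (1/4))"
  proof -
    have "complex_of_real (Gamma (1/4) * Gamma (3/4)) = complex_of_real (pi / sin (pi * (1/4)))"
      using Gamma_reflection_complex[of "complex_of_real (1/4)"]
      by (simp add: Gamma_complex_of_real[symmetric] sin_of_real[symmetric] del: of_real_divide)
         (simp add: Gamma_complex_of_real[symmetric] sin_of_real[symmetric])
    then show ?thesis by (simp only: of_real_eq_iff)
  qed
  ultimately have r: "Gamma (1/4 :: real) * Gamma (3/4) = pi * sqrt 2" by simp
  have pos: "Gamma (1/4 :: real) > 0" "Gamma (3/4 :: real) > 0" by (auto intro!: Gamma_real_pos)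
  have "Beta (1/4) (1/2 :: real) = Gamma (1/4) * sqrt pi / Gamma (3/4)"
    by (simp add: Beta_def Gamma_one_half_real)
  also have "\<dots> = (Gamma (1/4))\<^sup>2 * sqrt pi / (Gamma (1/4) * Gamma (3/4))"
    using pos by (simp add: power2_eq_square)
  finally show ?thesis
    unfolding r by (simp add: power_divide power_mult_distrib flip: power_mult) (simp add: power2_eq_square)
qed

text \<open>
  Here \<open>3 + cos \<psi> = 2 (1 + cos\<^sup>2 (\<psi>/2))\<close>, and the four quarter periods contribute equally.
\<close>

lemma integral_lemniscatic:
  "integral {0..2*pi} (\<lambda>\<psi>. 1 / sqrt (3 / (2 * sqrt 2) + 1 / (2 * sqrt 2) * cos \<psi>))
     = sqrt (sqrt 2) * Beta (1/4) (1/2)"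
proof -
  define f where "f = (\<lambda>x::real. 1 / sqrt (1 + (sin x)\<^sup>2))"
  define g where "g = (\<lambda>x::real. 1 / sqrt (1 + (cos x)\<^sup>2))"
  have nz: "1 + x\<^sup>2 \<noteq> 0" for x :: real
    using zero_le_power2[of x] by linarith
  have cont: "continuous_on S f" "continuous_on S g" for S
    unfolding f_def g_def using nz by (auto intro!: continuous_intros)
  have "3 / (2 * sqrt 2) + 1 / (2 * sqrt 2) * cos \<psi> = (1 + (cos (\<psi>/2))\<^sup>2) / sqrt 2" for \<psi>
  proof -
    have "cos \<psi> = 2 * (cos (\<psi>/2))\<^sup>2 - 1"
      using cos_double_cos[of "\<psi>/2"] by simp
    then show ?thesis by (simp only:) (simp add: field_simps)
  qed
  then have "integral {0..2*pi} (\<lambda>\<psi>. 1 / sqrt (3 / (2 * sqrt 2) + 1 / (2 * sqrt 2) * cos \<psi>))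
     = integral {0..2*pi} (\<lambda>\<psi>. sqrt (sqrt 2) * g (\<psi> / 2))"
    by (simp add: g_def real_sqrt_divide)
  also have "\<dots> = sqrt (sqrt 2) * (2 * integral {0..pi} g)"
    using integral_half_angle[OF cont(2)] by simp
  also have "integral {0..pi} g = integral {0..pi/2} g + integral {pi/2..pi} g"
    by (intro Henstock_Kurzweil_Integration.integral_combine[symmetric] integrable_continuous_real cont) auto
  also have "integral {pi/2..pi} g = integral {0..pi/2} f"
    using integral_shift[of 0 "pi/2" "pi/2" g] cont by (simp add: o_def f_def g_def cos_add)
  also have "integral {0..pi/2} g = integral {0..pi/2} f"
  proof -
    have "integral {0..pi/2} g = integral {-(pi/2)..-0} (\<lambda>x. g (-x))"
      by (rule Henstock_Kurzweil_Integration.integral_reflect_real[symmetric])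
    also have "\<dots> = integral {0..pi/2} f"
      using integral_shift[of "-(pi/2)" "pi/2" 0 f] cont by (simp add: o_def f_def g_def sin_add)
    finally show ?thesis .
  qed
  also have "integral {0..pi/2} f = Beta (1/4) (1/2) / 4"
    unfolding f_def by (rule integral_one_plus_sin_squared)
  finally show ?thesis by simp
qed

section \<open>Averages against the complete elliptic integral\<close>

lemma ellipticK_nonneg:
  assumes "\<bar>k\<bar> \<le> 1"
  shows "ellipticK k \<ge> 0"
proof (cases "(\<lambda>\<theta>. 1 / sqrt (1 - k\<^sup>2 * (sin \<theta>)\<^sup>2)) integrable_on {0..pi/2}")
  case True
  have "k\<^sup>2 * (sin \<theta>)\<^sup>2 \<le> 1" for \<theta>
    using assms by (intro mult_le_one) (auto simp: abs_square_le_1)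
  with True show ?thesis
    unfolding ellipticK_def by (intro Henstock_Kurzweil_Integration.integral_nonneg) auto
qed (simp add: ellipticK_def not_integrable_integral)

text \<open>
  The joint kernel behind step (1): its integral over \<open>\<theta>\<close> is the complete elliptic integral, while
  for fixed \<open>\<theta>\<close> it is the (unnormalised) arcsine density on \<open>[- cos \<theta>, cos \<theta>]\<close>.
\<close>

definition arcsine_kernel :: "real \<Rightarrow> real \<Rightarrow> real" where
  "arcsine_kernel \<theta> z = (if z\<^sup>2 < (cos \<theta>)\<^sup>2 then 1 / sqrt ((cos \<theta>)\<^sup>2 - z\<^sup>2) else 0)"

lemma arcsine_kernel_nonneg: "arcsine_kernel \<theta> z \<ge> 0"
  by (simp add: arcsine_kernel_def)

lemma arcsine_kernel_measurable: "(\<lambda>(z, \<theta>). arcsine_kernel \<theta> z) \<in> borel_measurable (lborel \<Otimes>\<^sub>M lborel)"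
  unfolding arcsine_kernel_def by measurable

text \<open>
  The substitution \<open>sin \<theta> = k sin t\<close> in the defining integral, where \<open>k\<^sup>2 = 1 - z\<^sup>2\<close>. Both ends of the
  range of \<open>z\<close> and the centre are exceptional: for \<open>z = 0\<close> the modulus is 1 and the left-hand side is
  infinite, and for \<open>\<bar>z\<bar> = 1\<close> the kernel vanishes although the elliptic integral is \<open>\<pi>/2\<close>.
\<close>

lemma nn_integral_arcsine_kernel:
  assumes z: "-1 < z" "z < 1" "z \<noteq> 0"
  shows "(\<integral>\<^sup>+\<theta>. ennreal (arcsine_kernel \<theta> z) * indicator {0..pi/2} \<theta> \<partial>lborel) = ennreal (ellipticK (sqrt (1 - z\<^sup>2)))"
proof -
  define k where "k = sqrt (1 - z\<^sup>2)"
  have "z\<^sup>2 < 1" "z\<^sup>2 > 0" using z by (auto simp: abs_square_less_1 abs_less_iff)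
  then have k: "0 < k" "k < 1" and k2: "k\<^sup>2 = 1 - z\<^sup>2" by (auto simp: k_def)
  have ks: "\<bar>k * sin t\<bar> < 1" for t
    using k abs_mult_cos_le[of k "t - pi/2"] by (simp add: cos_diff)
  have rad: "1 - (k * sin t)\<^sup>2 > 0" for t
    using ks[of t] by (simp add: abs_square_less_1)
  define f where "f = (\<lambda>\<theta>. 1 / sqrt (k\<^sup>2 - (sin \<theta>)\<^sup>2))"
  define g where "g = (\<lambda>t. arcsin (k * sin t))"
  define g' where "g' = (\<lambda>t. k * cos t / sqrt (1 - (k * sin t)\<^sup>2))"
  have "(\<integral>\<^sup>+\<theta>. ennreal (arcsine_kernel \<theta> z) * indicator {0..pi/2} \<theta> \<partial>lborel)
      = (\<integral>\<^sup>+\<theta>. ennreal (f \<theta> * indicator {g 0..g (pi/2)} \<theta>) \<partial>lborel)"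
  proof (intro nn_integral_cong)
    fix \<theta> :: real
    have e: "(cos \<theta>)\<^sup>2 - z\<^sup>2 = k\<^sup>2 - (sin \<theta>)\<^sup>2"
      unfolding k2 cos_squared_eq by simp
    have g: "g 0 = 0" "g (pi/2) = arcsin k" by (auto simp: g_def)
    have ak: "arcsin k \<le> pi/2" using k arcsin_bounded[of k] by simp
    show "ennreal (arcsine_kernel \<theta> z) * indicator {0..pi/2} \<theta> = ennreal (f \<theta> * indicator {g 0..g (pi/2)} \<theta>)"
    proof (cases "0 \<le> \<theta> \<and> \<theta> \<le> pi/2")
      case True
      have "\<theta> \<le> arcsin k \<longleftrightarrow> sin \<theta> \<le> k"
        using True k arcsin_le_mono[of "sin \<theta>" k] arcsin_sin[of \<theta>] by simp
      also have "\<dots> \<longleftrightarrow> (sin \<theta>)\<^sup>2 \<le> k\<^sup>2"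
        using True k sin_ge_zero[of \<theta>] by (auto simp: power_mono_iff)
      finally have "\<theta> \<le> arcsin k \<longleftrightarrow> z\<^sup>2 \<le> (cos \<theta>)\<^sup>2"
        using e by linarith
      moreover have "f \<theta> = 0" if "z\<^sup>2 = (cos \<theta>)\<^sup>2" using that e by (simp add: f_def)
      ultimately show ?thesis
        using True e by (auto simp: arcsine_kernel_def g f_def indicator_def)
    next
      case False
      then show ?thesis using ak by (auto simp: g indicator_def)
    qed
  qed
  also have "\<dots> = (\<integral>\<^sup>+t. ennreal (f (g t) * g' t * indicator {0..pi/2} t) \<partial>lborel)"
  proof (rule nn_integral_substitution)
    show "set_borel_measurable borel {g 0..g (pi/2)} f"
      unfolding set_borel_measurable_def f_def by measurable
    show "(g has_real_derivative g' t) (at t)" for t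
      unfolding g_def g'_def using ks[of t]
      by (auto intro!: derivative_eq_intros simp: abs_less_iff divide_inverse)
    show "continuous_on {0..pi/2} g'"
      unfolding g'_def using rad by (auto intro!: continuous_intros simp: less_imp_neq[symmetric])
    show "g' t \<ge> 0" if "t \<in> {0..pi/2}" for t
      unfolding g'_def using that k rad[of t]
      by (intro divide_nonneg_nonneg mult_nonneg_nonneg cos_ge_zero) (auto intro: less_imp_le)
  qed simp
  also have "\<dots> = (\<integral>\<^sup>+t. ennreal (1 / sqrt (1 - k\<^sup>2 * (sin t)\<^sup>2)) * indicator {0..pi/2} t \<partial>lborel)"
  proof (rule nn_integral_cong_AE)
    have "f (g t) * g' t = 1 / sqrt (1 - k\<^sup>2 * (sin t)\<^sup>2)" if "0 \<le> t" "t < pi/2" for t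
    proof -
      have c: "cos t > 0" using that by (intro cos_gt_zero_pi) auto
      have "k\<^sup>2 - (sin (g t))\<^sup>2 = (k * cos t)\<^sup>2"
        unfolding g_def using ks[of t]
        by (simp add: abs_less_iff power_mult_distrib cos_squared_eq algebra_simps)
      then have "f (g t) = 1 / (k * cos t)"
        using k c by (simp add: f_def)
      then show ?thesis
        using k c by (simp add: g'_def power_mult_distrib)
    qed
    note pointwise = this
    show "AE t in lborel. ennreal (f (g t) * g' t * indicator {0..pi/2} t)
            = ennreal (1 / sqrt (1 - k\<^sup>2 * (sin t)\<^sup>2)) * indicator {0..pi/2} t"
      using AE_lborel_singleton[of "pi/2"]
      by eventually_elim (use pointwise in \<open>auto simp: indicator_def\<close>)
  qed
  also have "\<dots> = ennreal (ellipticK k)"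
    unfolding ellipticK_def
  proof (rule nn_integral_has_integral_lebesgue')
    show "((\<lambda>t. 1 / sqrt (1 - k\<^sup>2 * (sin t)\<^sup>2)) has_integral
            integral {0..pi/2} (\<lambda>t. 1 / sqrt (1 - k\<^sup>2 * (sin t)\<^sup>2))) {0..pi/2}"
      using rad by (intro integrable_integral integrable_continuous_real continuous_intros)
                   (auto simp: power_mult_distrib less_imp_neq[symmetric])
    show "0 \<le> 1 / sqrt (1 - k\<^sup>2 * (sin t)\<^sup>2)" for t
      using rad[of t] by (simp add: power_mult_distrib)
  qed
  finally show ?thesis by (simp add: k_def)
qed

text \<open>
  The arcsine substitution \<open>z = - cos \<theta> cos \<psi>\<close>; the minus sign makes it increasing in \<open>\<psi>\<close>.
\<close>

lemma nn_integral_arcsine_kernel_section: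
  fixes g :: "real \<Rightarrow> real"
  assumes g: "g \<in> borel_measurable borel" and \<theta>: "0 \<le> \<theta>" "\<theta> < pi/2"
  shows "(\<integral>\<^sup>+z. ennreal (g z * arcsine_kernel \<theta> z) \<partial>lborel)
       = (\<integral>\<^sup>+\<psi>. ennreal (g (- (cos \<theta> * cos \<psi>)) * indicator {0..pi} \<psi>) \<partial>lborel)"
proof -
  define a where "a = cos \<theta>"
  have a: "a > 0" unfolding a_def using \<theta> by (intro cos_gt_zero_pi) auto
  define f where "f = (\<lambda>z. g z * (1 / sqrt (a\<^sup>2 - z\<^sup>2)))"
  have "(\<integral>\<^sup>+z. ennreal (g z * arcsine_kernel \<theta> z) \<partial>lborel)
      = (\<integral>\<^sup>+z. ennreal (f z * indicator {- (a * cos 0)..- (a * cos pi)} z) \<partial>lborel)"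
  proof (intro nn_integral_cong)
    fix z
    have "z\<^sup>2 \<le> a\<^sup>2 \<longleftrightarrow> \<bar>z\<bar> \<le> a"
      using a abs_le_square_iff[of z a] by simp
    then show "ennreal (g z * arcsine_kernel \<theta> z) = ennreal (f z * indicator {- (a * cos 0)..- (a * cos pi)} z)"
      by (cases "z\<^sup>2 = a\<^sup>2") (auto simp: arcsine_kernel_def f_def a_def[symmetric] indicator_def abs_le_iff)
  qed
  also have "\<dots> = (\<integral>\<^sup>+\<psi>. ennreal (f (- (a * cos \<psi>)) * (a * sin \<psi>) * indicator {0..pi} \<psi>) \<partial>lborel)"
  proof (rule nn_integral_substitution)
    show "set_borel_measurable borel {- (a * cos 0)..- (a * cos pi)} f"
      unfolding set_borel_measurable_def f_def using g by measurable
    show "((\<lambda>\<psi>. - (a * cos \<psi>)) has_real_derivative a * sin \<psi>) (at \<psi>)" for \<psi>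
      by (auto intro!: derivative_eq_intros)
    show "continuous_on {0..pi} (\<lambda>\<psi>. a * sin \<psi>)" by (intro continuous_intros)
    show "a * sin \<psi> \<ge> 0" if "\<psi> \<in> {0..pi}" for \<psi>
      using a that by (intro mult_nonneg_nonneg sin_ge_zero) auto
  qed simp
  also have "\<dots> = (\<integral>\<^sup>+\<psi>. ennreal (g (- (a * cos \<psi>)) * indicator {0..pi} \<psi>) \<partial>lborel)"
  proof (rule nn_integral_cong_AE)
    have "f (- (a * cos \<psi>)) * (a * sin \<psi>) = g (- (a * cos \<psi>))" if "0 < \<psi>" "\<psi> < pi" for \<psi>
    proof -
      have s: "sin \<psi> > 0" using that by (intro sin_gt_zero)
      have "a\<^sup>2 - (- (a * cos \<psi>))\<^sup>2 = (a * sin \<psi>)\<^sup>2"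
        unfolding power2_minus power_mult_distrib sin_squared_eq by (simp add: algebra_simps)
      then show ?thesis using a s by (simp add: f_def)
    qed
    note pointwise = this
    show "AE \<psi> in lborel. ennreal (f (- (a * cos \<psi>)) * (a * sin \<psi>) * indicator {0..pi} \<psi>)
         = ennreal (g (- (a * cos \<psi>)) * indicator {0..pi} \<psi>)"
      using AE_lborel_singleton[of 0] AE_lborel_singleton[of pi]
      by eventually_elim (use pointwise in \<open>auto simp: indicator_def\<close>)
  qed
  finally show ?thesis by (simp add: a_def)
qed

text \<open>
  Integrate \<open>g z\<close> times the joint kernel in both orders. All integrands are nonnegative, so Tonelli's
  theorem takes care of the logarithmic singularity of the elliptic integral at \<open>z = 0\<close>.
\<close>

lemma ellipticK_has_integral:
  fixes g :: "real \<Rightarrow> real"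
  assumes cont: "continuous_on {-1..1} g" and nonneg: "\<And>z. z \<in> {-1..1} \<Longrightarrow> g z \<ge> 0"
  shows "((\<lambda>z. g z * ellipticK (sqrt (1 - z\<^sup>2))) has_integral
           integral {0..pi/2} (\<lambda>\<theta>. integral {0..pi} (\<lambda>\<psi>. g (- (cos \<theta> * cos \<psi>))))) {-1..1}"
proof -
  define G where "G z = indicator {-1..1} z * g z" for z
  have G_meas [measurable]: "G \<in> borel_measurable borel"
    unfolding G_def using borel_measurable_continuous_on_indicator[OF _ cont] by simp
  have G_nonneg: "G z \<ge> 0" for z using nonneg by (auto simp: G_def indicator_def)
  have cc: "\<bar>cos \<theta> * cos \<psi>\<bar> \<le> 1" for \<theta> \<psi> :: real
    using mult_mono[OF abs_cos_le_one[of \<theta>] abs_cos_le_one[of \<psi>]] by (simp add: abs_mult)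
  have rng: "- (cos \<theta> * cos \<psi>) \<in> {-1..1}" for \<theta> \<psi> :: real
    using cc[of \<theta> \<psi>] by (auto simp: abs_le_iff)
  define I where "I \<theta> = integral {0..pi} (\<lambda>\<psi>. g (- (cos \<theta> * cos \<psi>)))" for \<theta>
  have I_cont: "continuous_on {0..pi/2} I"
  proof -
    have "continuous_on ({0..pi/2} \<times> cbox 0 pi) (\<lambda>(\<theta>, \<psi>). g (- (cos \<theta> * cos \<psi>)))"
      unfolding case_prod_unfold
      by (rule continuous_on_compose2[OF cont]) (use rng in \<open>auto intro!: continuous_intros\<close>)
    from integral_continuous_on_param[OF this] show ?thesis by (simp add: I_def)
  qed
  have inner_int: "((\<lambda>\<psi>. g (- (cos \<theta> * cos \<psi>))) has_integral I \<theta>) {0..pi}" for \<theta>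
    unfolding I_def
    by (intro integrable_integral integrable_continuous_real continuous_on_compose2[OF cont] continuous_intros)
       (use rng in auto)
  have I_nonneg: "I \<theta> \<ge> 0" for \<theta>
    by (rule has_integral_nonneg[OF inner_int]) (use nonneg rng in auto)
  \<comment> \<open>a Borel version of the elliptic integral; the two agree off \<open>{-1, 0, 1}\<close>\<close>
  define N where "N z = (\<integral>\<^sup>+\<theta>. ennreal (arcsine_kernel \<theta> z) * indicator {0..pi/2} \<theta> \<partial>lborel)" for z
  have arcsine_kernel_meas [measurable]: "(\<lambda>p. arcsine_kernel (snd p) (fst p)) \<in> borel_measurable (lborel \<Otimes>\<^sub>M lborel)"
    using arcsine_kernel_measurable by (simp add: case_prod_unfold)
  have N_meas [measurable]: "N \<in> borel_measurable borel"
  proof -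
    have "(\<lambda>z. \<integral>\<^sup>+\<theta>. ennreal (arcsine_kernel \<theta> z) * indicator {0..pi/2} \<theta> \<partial>lborel) \<in> borel_measurable lborel"
      by (rule lborel.borel_measurable_nn_integral) (simp add: case_prod_unfold)
    then show ?thesis by (simp add: N_def[abs_def])
  qed
  define F where "F z = G z * enn2real (N z)" for z
  have F_meas: "F \<in> borel_measurable borel" unfolding F_def by measurable
  have "(\<integral>\<^sup>+z. ennreal (F z) \<partial>lborel) = (\<integral>\<^sup>+z. (\<integral>\<^sup>+\<theta>. ennreal (G z * arcsine_kernel \<theta> z) * indicator {0..pi/2} \<theta> \<partial>lborel) \<partial>lborel)"
  proof (rule nn_integral_cong_AE)
    have "ennreal (F z) = (\<integral>\<^sup>+\<theta>. ennreal (G z * arcsine_kernel \<theta> z) * indicator {0..pi/2} \<theta> \<partial>lborel)"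
      if "z \<noteq> 0" "z \<noteq> 1" "z \<noteq> -1" for z
    proof (cases "-1 < z \<and> z < 1")
      case True
      then have "ennreal (F z) = ennreal (G z) * N z"
        using that nn_integral_arcsine_kernel[of z] by (simp add: F_def N_def ennreal_mult'' G_nonneg)
      also have "\<dots> = (\<integral>\<^sup>+\<theta>. ennreal (G z) * (ennreal (arcsine_kernel \<theta> z) * indicator {0..pi/2} \<theta>) \<partial>lborel)"
        unfolding N_def by (rule nn_integral_cmult[symmetric]) (simp add: arcsine_kernel_def)
      finally show ?thesis
        by (simp add: ennreal_mult G_nonneg arcsine_kernel_nonneg mult.assoc)
    next
      case False
      then have "G z = 0" using that by (auto simp: G_def indicator_def)
      then show ?thesis by (simp add: F_def)
    qed
    note pointwise = this
    show "AE z in lborel. ennreal (F z) = (\<integral>\<^sup>+\<theta>. ennreal (G z * arcsine_kernel \<theta> z) * indicator {0..pi/2} \<theta> \<partial>lborel)"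
      using AE_lborel_singleton[of 0] AE_lborel_singleton[of 1] AE_lborel_singleton[of "-1"]
      by eventually_elim (use pointwise in auto)
  qed
  also have "\<dots> = (\<integral>\<^sup>+\<theta>. (\<integral>\<^sup>+z. ennreal (G z * arcsine_kernel \<theta> z) * indicator {0..pi/2} \<theta> \<partial>lborel) \<partial>lborel)"
    by (rule lborel_pair.Fubini'[symmetric]) (simp add: case_prod_unfold)
  also have "\<dots> = (\<integral>\<^sup>+\<theta>. ennreal (I \<theta>) * indicator {0..pi/2} \<theta> \<partial>lborel)"
  proof (rule nn_integral_cong_AE)
    have "(\<integral>\<^sup>+z. ennreal (G z * arcsine_kernel \<theta> z) * indicator {0..pi/2} \<theta> \<partial>lborel) = ennreal (I \<theta>) * indicator {0..pi/2} \<theta>"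
      if "\<theta> \<noteq> pi/2" for \<theta>
    proof (cases "\<theta> \<in> {0..pi/2}")
      case True
      have "(\<integral>\<^sup>+z. ennreal (G z * arcsine_kernel \<theta> z) \<partial>lborel)
          = (\<integral>\<^sup>+\<psi>. ennreal (G (- (cos \<theta> * cos \<psi>)) * indicator {0..pi} \<psi>) \<partial>lborel)"
        using True that by (intro nn_integral_arcsine_kernel_section G_meas) auto
      also have "\<dots> = (\<integral>\<^sup>+\<psi>. ennreal (g (- (cos \<theta> * cos \<psi>))) * indicator {0..pi} \<psi> \<partial>lborel)"
        using rng by (intro nn_integral_cong) (auto simp: G_def indicator_def)
      also have "\<dots> = ennreal (I \<theta>)"
        by (rule nn_integral_has_integral_lebesgue'[OF _ inner_int]) (use nonneg rng in auto)
      finally show ?thesis using True by simp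
    qed simp
    note pointwise = this
    show "AE \<theta> in lborel. (\<integral>\<^sup>+z. ennreal (G z * arcsine_kernel \<theta> z) * indicator {0..pi/2} \<theta> \<partial>lborel)
         = ennreal (I \<theta>) * indicator {0..pi/2} \<theta>"
      using AE_lborel_singleton[of "pi/2"]
      by eventually_elim (use pointwise in auto)
  qed
  also have "\<dots> = ennreal (integral {0..pi/2} I)"
    by (rule nn_integral_has_integral_lebesgue')
       (auto intro!: I_nonneg integrable_integral integrable_continuous_real I_cont)
  finally have nn: "(\<integral>\<^sup>+z. ennreal (F z) \<partial>lborel) = ennreal (integral {0..pi/2} I)" .
  have "(F has_integral (integral {0..pi/2} I)) UNIV"
  proof (rule nn_integral_has_integral[OF F_meas _ nn])
    show "F z \<ge> 0" for z by (simp add: F_def G_nonneg)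
    show "integral {0..pi/2} I \<ge> 0"
      by (intro Henstock_Kurzweil_Integration.integral_nonneg integrable_continuous_real I_cont I_nonneg)
  qed
  moreover have "F = (\<lambda>z. if z \<in> {-1..1} then F z else 0)"
    by (auto simp: F_def G_def)
  ultimately have F_int: "(F has_integral (integral {0..pi/2} I)) {-1..1}"
    using has_integral_restrict_UNIV[of "{-1..1}" F] by simp
  have F_eq: "F z = g z * ellipticK (sqrt (1 - z\<^sup>2))" if "z \<in> {-1..1} - {-1, 0, 1}" for z
  proof -
    have "ennreal (ellipticK (sqrt (1 - z\<^sup>2))) = N z"
      using that nn_integral_arcsine_kernel[of z] by (simp add: N_def)
    moreover have "ellipticK (sqrt (1 - z\<^sup>2)) \<ge> 0"
      by (rule ellipticK_nonneg) (use that in \<open>auto simp: abs_square_le_1 abs_le_iff\<close>)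
    ultimately show ?thesis
      using that by (simp add: F_def G_def flip: \<open>_ = N z\<close>)
  qed
  have "((\<lambda>z. g z * ellipticK (sqrt (1 - z\<^sup>2))) has_integral (integral {0..pi/2} I)) {-1..1}"
    by (rule has_integral_spike_finite[OF _ _ F_int, of "{-1, 0, 1}"]) (use F_eq in auto)
  then show ?thesis unfolding I_def .
qed

section \<open>The evaluation\<close>

theorem mainTheorem3:
  shows "((\<lambda>x::real. ellipticK (2 * sqrt (x * (1 - x))) / sqrt (9/8 + (1 - 2*x) / sqrt 2))
           has_integral (Gamma (1/4 :: real)) ^ 4 / (16 * sqrt 2 * pi)) {0..1}"
proof -
  define h :: real where "h = 1 / (2 * sqrt 2)"
  define c :: real where "c = 3 / (2 * sqrt 2)"
  have h2: "h\<^sup>2 = 1/8" and c2: "c\<^sup>2 = 9/8" by (simp_all add: h_def c_def power_divide power_mult_distrib)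
  have hpos: "0 \<le> h" "0 < c" by (simp_all add: h_def c_def)
  have h2': "2 * h = 1 / sqrt 2" by (simp add: h_def)
  have "2 * h < 1 - h\<^sup>2"
  proof -
    have "2 * h < 7/8"
      by (rule power2_less_imp_less) (auto simp: power_mult_distrib h2 power2_eq_square[of "7/8"])
    then show ?thesis by (simp add: h2)
  qed
  moreover have "h < 1"
    by (rule power2_less_imp_less) (auto simp: h2)
  ultimately have series: "integral {0..pi/2} (\<lambda>\<theta>. integral {0..pi} (\<lambda>\<psi>. 1 / sqrt (1 + h\<^sup>2 - 2 * h * (cos \<theta> * cos \<psi>))))
           = pi\<^sup>2 / 2 * (\<Sum>n. inv_sqrt_coeff n ^ 3 * (- (h\<^sup>2)) ^ n)"
    using hpos by (intro integral_distance_series)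
  have "4 * pi\<^sup>2 * (\<Sum>n. inv_sqrt_coeff n ^ 3 * (- (h\<^sup>2)) ^ n) = (integral {0..2*pi} (\<lambda>\<psi>. 1 / sqrt (c + h * cos \<psi>)))\<^sup>2"
    using integral_torus_series[of "h\<^sup>2"] legendre_product_formula[of c h] hpos
    by (simp add: h2 c2)
  also have "\<dots> = (sqrt (sqrt 2) * Beta (1/4) (1/2))\<^sup>2"
    unfolding c_def h_def integral_lemniscatic ..
  also have "\<dots> = sqrt 2 * Gamma (1/4) ^ 4 / (2 * pi)"
    by (simp add: power_mult_distrib Beta_quarter_half_squared)
  finally have S: "4 * pi\<^sup>2 * (\<Sum>n. inv_sqrt_coeff n ^ 3 * (- (h\<^sup>2)) ^ n) = sqrt 2 * Gamma (1/4) ^ 4 / (2 * pi)" .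
  define g where "g z = 1 / sqrt (9/8 + z / sqrt 2)" for z
  have pos: "9/8 + z / sqrt 2 > 0" if "z \<in> {-1..1}" for z
  proof -
    have "- (1 / sqrt 2) \<le> z / sqrt 2"
      using that divide_right_mono[of "-1" z "sqrt 2"] by simp
    moreover have "1 / sqrt 2 \<le> (1::real)" by simp
    ultimately show ?thesis by linarith
  qed
  have g_cont: "continuous_on {-1..1} g"
    unfolding g_def using pos by (intro continuous_intros) (auto simp: less_imp_neq[symmetric])
  have g_nonneg: "g z \<ge> 0" if "z \<in> {-1..1}" for z
    using pos[OF that] by (simp add: g_def)
  have "integral {0..pi/2} (\<lambda>\<theta>. integral {0..pi} (\<lambda>\<psi>. g (- (cos \<theta> * cos \<psi>))))
     = sqrt 2 * Gamma (1/4) ^ 4 / (16 * pi)"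
  proof -
    have "g (- (cos \<theta> * cos \<psi>)) = 1 / sqrt (1 + h\<^sup>2 - 2 * h * (cos \<theta> * cos \<psi>))" for \<theta> \<psi>
      unfolding h2' h2 g_def by simp
    then have "integral {0..pi/2} (\<lambda>\<theta>. integral {0..pi} (\<lambda>\<psi>. g (- (cos \<theta> * cos \<psi>))))
        = 4 * pi\<^sup>2 * (\<Sum>n. inv_sqrt_coeff n ^ 3 * (- (h\<^sup>2)) ^ n) / 8"
      using series by simp
    then show ?thesis unfolding S by simp
  qed
  with ellipticK_has_integral[OF g_cont g_nonneg]
  have "((\<lambda>z. g z * ellipticK (sqrt (1 - z\<^sup>2))) has_integral sqrt 2 * Gamma (1/4) ^ 4 / (16 * pi)) (cbox (-1) 1)"
    by simp
  from has_integral_affinity[OF this, of "-2" 1]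
  have "((\<lambda>x. g (1 - 2 * x) * ellipticK (sqrt (1 - (1 - 2 * x)\<^sup>2))) has_integral
       1/2 * (sqrt 2 * Gamma (1/4) ^ 4 / (16 * pi))) ((\<lambda>x. 1/2 - x / 2) ` {-1..1})"
    by (simp add: algebra_simps)
  also have "(\<lambda>x::real. 1/2 - x / 2) ` {-1..1} = {0..1}"
  proof (intro equalityI subsetI)
    fix y :: real assume "y \<in> {0..1}"
    then show "y \<in> (\<lambda>x. 1/2 - x / 2) ` {-1..1}"
      by (intro image_eqI[of _ _ "1 - 2 * y"]) (auto simp: field_simps)
  qed auto
  also have "1/2 * (sqrt 2 * Gamma (1/4) ^ 4 / (16 * pi)) = Gamma (1/4 :: real) ^ 4 / (16 * sqrt 2 * pi)"
    by (simp add: field_simps)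
  finally show ?thesis
  proof (rule has_integral_eq[rotated])
    fix x :: real assume "x \<in> {0..1}"
    have "1 - (1 - 2 * x)\<^sup>2 = 2\<^sup>2 * (x * (1 - x))" by (simp add: power2_eq_square algebra_simps)
    then have "sqrt (1 - (1 - 2 * x)\<^sup>2) = 2 * sqrt (x * (1 - x))"
      by (simp only: real_sqrt_mult) simp
    then show "g (1 - 2 * x) * ellipticK (sqrt (1 - (1 - 2 * x)\<^sup>2)) =
       ellipticK (2 * sqrt (x * (1 - x))) / sqrt (9/8 + (1 - 2*x) / sqrt 2)"
      by (simp add: g_def)
  qed
qed

end
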